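(* Let $T$ be an algebraic torus over an algebraically closed field $k$, with character lattice $\Lambda$, acting linearly on $V=k^n$ by $t(x_1,\ldots,x_n)=(\chi_1(t)x_1,\ldots,\chi_n(t)x_n)$ with $\chi_1,\ldots,\chi_n\in\Lambda$. Suppose that the orbit closure $X=\overline{T(1,\ldots,1)}\subset V$ is a cone (of dimension $\geq 2$). Then $X$ satisfies the strong separation property (SSP) if and only if $X=V$ (i.e., the weights $\chi_1,\ldots,\chi_n$ are linearly independent).
   Context: A closed affine cone in $V$ is a Zariski closed subset stable under multiplication by scalars from $k$. A closed affine cone $X\subseteq V$ of dimension $\geq 2$ has the strong separation property (SSP) if for any linear subspace $W\subseteq V$ of codimension 2 we have $\mathrm{codim}_X(W\cap X)=2$. Closures are Zariski closures. Linear independence of characters is in $\Lambda\otimes_{\mathbb{Z}}\mathbb{Q}$. *)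

theory Defs
  imports
    "HOL-Analysis.Analysis"
    "HOL-Computational_Algebra.Polynomial"
    "HOL-Library.Poly_Mapping"
begin

section \<open>The Zariski topology on affine space\<close>

text \<open>Polynomials in the finitely many variables \<open>'n\<close>: finitely supported functions
  from exponent vectors to coefficients.\<close>

type_synonym ('n, 'k) mpoly = "('n \<Rightarrow>\<^sub>0 nat) \<Rightarrow>\<^sub>0 'k"

definition eval_mpoly :: "('n::finite, 'k::field) mpoly \<Rightarrow> 'k ^ 'n \<Rightarrow> 'k" where
  "eval_mpoly p x =
     (\<Sum>m\<in>Poly_Mapping.keys p.
        Poly_Mapping.lookup p m * (\<Prod>i\<in>UNIV. (x $ i) ^ Poly_Mapping.lookup m i))"

definition zero_locus :: "('n::finite, 'k::field) mpoly set \<Rightarrow> ('k ^ 'n) set" where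
  "zero_locus S = {x. \<forall>p\<in>S. eval_mpoly p x = 0}"

definition zariski :: "('k::field ^ 'n::finite) topology" where
  "zariski = topology (\<lambda>U. \<exists>S. U = - zero_locus S)"

lemma eval_mpoly_Sum:
  assumes "finite A" "Poly_Mapping.keys p \<subseteq> A"
  shows "eval_mpoly p x =
    (\<Sum>m\<in>A. Poly_Mapping.lookup p m * (\<Prod>i\<in>UNIV. (x $ i) ^ Poly_Mapping.lookup m i))"
  unfolding eval_mpoly_def
  by (rule sum.mono_neutral_left) (use assms in \<open>auto simp: in_keys_iff\<close>)

lemma eval_mpoly_add: "eval_mpoly (p + q) x = eval_mpoly p x + eval_mpoly q x"
proof -
  let ?A = "Poly_Mapping.keys p \<union> Poly_Mapping.keys q"
  have "Poly_Mapping.keys (p + q) \<subseteq> ?A"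
    by (rule keys_add)
  then show ?thesis
    by (simp add: eval_mpoly_Sum[of ?A] lookup_add distrib_right sum.distrib)
qed

lemma eval_mpoly_0 [simp]: "eval_mpoly 0 x = 0"
  by (simp add: eval_mpoly_def)

lemma eval_mpoly_sum: "eval_mpoly (\<Sum>a\<in>A. f a) x = (\<Sum>a\<in>A. eval_mpoly (f a) x)"
  by (induction A rule: infinite_finite_induct) (auto simp: eval_mpoly_add)

lemma eval_mpoly_single:
  "eval_mpoly (Poly_Mapping.single m c) x = c * (\<Prod>i\<in>UNIV. (x $ i) ^ Poly_Mapping.lookup m i)"
  by (subst eval_mpoly_Sum[of "{m}"]) auto

lemma eval_mpoly_1 [simp]: "eval_mpoly 1 x = 1"
  using eval_mpoly_single[of 0 1 x] by simp

lemma poly_mapping_eq_sum_single: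
  fixes p :: "'a \<Rightarrow>\<^sub>0 'b::comm_monoid_add"
  shows "p = (\<Sum>m\<in>Poly_Mapping.keys p. Poly_Mapping.single m (Poly_Mapping.lookup p m))"
proof (rule poly_mapping_eqI)
  fix k
  show "Poly_Mapping.lookup p k = Poly_Mapping.lookup
    (\<Sum>m\<in>Poly_Mapping.keys p. Poly_Mapping.single m (Poly_Mapping.lookup p m)) k"
    by (auto simp: lookup_sum lookup_single when_def in_keys_iff sum.delta)
qed

lemma eval_mpoly_mult: "eval_mpoly (p * q) x = eval_mpoly p x * eval_mpoly q x"
proof -
  let ?s = "\<lambda>p m. Poly_Mapping.single m (Poly_Mapping.lookup p m)"
  have "p * q = (\<Sum>m\<in>Poly_Mapping.keys p. ?s p m) * (\<Sum>m'\<in>Poly_Mapping.keys q. ?s q m')"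
    by (rule arg_cong2[where f = "(*)"]; rule poly_mapping_eq_sum_single)
  also have "\<dots> = (\<Sum>m\<in>Poly_Mapping.keys p. \<Sum>m'\<in>Poly_Mapping.keys q. ?s p m * ?s q m')"
    by (simp add: sum_product)
  finally have "eval_mpoly (p * q) x =
      (\<Sum>m\<in>Poly_Mapping.keys p. \<Sum>m'\<in>Poly_Mapping.keys q. eval_mpoly (?s p m * ?s q m') x)"
    by (simp add: eval_mpoly_sum)
  also have "\<dots> = (\<Sum>m\<in>Poly_Mapping.keys p. \<Sum>m'\<in>Poly_Mapping.keys q.
      eval_mpoly (?s p m) x * eval_mpoly (?s q m') x)"
    by (intro sum.cong refl)
      (simp add: mult_single eval_mpoly_single lookup_add power_add prod.distrib)
  also have "\<dots> = eval_mpoly p x * eval_mpoly q x"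
    unfolding eval_mpoly_single by (simp add: eval_mpoly_def sum_product)
  finally show ?thesis .
qed

lemma zero_locus_Un:
  "zero_locus S \<union> zero_locus T = zero_locus {p * q |p q. p \<in> S \<and> q \<in> T}"
proof (intro set_eqI iffI)
  fix x
  assume x: "x \<in> zero_locus {p * q |p q. p \<in> S \<and> q \<in> T}"
  have "eval_mpoly p x = 0 \<or> eval_mpoly q x = 0" if "p \<in> S" "q \<in> T" for p q
  proof -
    have "eval_mpoly (p * q) x = 0"
      using x that unfolding zero_locus_def by blast
    then show ?thesis
      by (simp add: eval_mpoly_mult)
  qed
  then show "x \<in> zero_locus S \<union> zero_locus T"
    unfolding zero_locus_def by blast
qed (auto simp: zero_locus_def eval_mpoly_mult)

lemma zero_locus_UN: "zero_locus (\<Union>i\<in>I. S i) = (\<Inter>i\<in>I. zero_locus (S i))"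
  by (auto simp: zero_locus_def)

lemma istopology_zariski:
  "istopology (\<lambda>U :: ('k::field ^ 'n::finite) set. \<exists>S. U = - zero_locus S)"
  unfolding istopology_def
proof (intro conjI allI impI)
  fix U V :: "('k ^ 'n) set"
  assume "\<exists>S. U = - zero_locus S" "\<exists>S. V = - zero_locus S"
  then obtain S T where "U = - zero_locus S" "V = - zero_locus T"
    by blast
  then have "U \<inter> V = - zero_locus {p * q |p q. p \<in> S \<and> q \<in> T}"
    by (simp only: zero_locus_Un[symmetric] Compl_Un)
  then show "\<exists>S. U \<inter> V = - zero_locus S"
    by (rule exI)
next
  fix \<K> :: "('k ^ 'n) set set"
  assume "\<forall>K\<in>\<K>. \<exists>S. K = - zero_locus S"
  then have "\<exists>S. \<forall>K\<in>\<K>. K = - zero_locus (S K)"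
    by (rule bchoice)
  then obtain S where S: "\<And>K. K \<in> \<K> \<Longrightarrow> K = - zero_locus (S K)"
    by blast
  have "(\<Union>K\<in>\<K>. K) = (\<Union>K\<in>\<K>. - zero_locus (S K))"
    by (rule SUP_cong[OF refl S])
  then have "\<Union>\<K> = - zero_locus (\<Union>K\<in>\<K>. S K)"
    by (simp add: zero_locus_UN)
  then show "\<exists>S. \<Union>\<K> = - zero_locus S"
    by blast
qed

lemma openin_zariski: "openin zariski U \<longleftrightarrow> (\<exists>S. U = - zero_locus S)"
  by (simp add: zariski_def istopology_zariski)

lemma topspace_zariski [simp]: "topspace zariski = UNIV"
proof -
  have "openin zariski (UNIV :: ('k::field ^ 'n::finite) set)"
    unfolding openin_zariski
    by (rule exI[of _ "{1}"]) (auto simp: zero_locus_def)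
  then show ?thesis
    by (metis openin_subset top.extremum_uniqueI)
qed

lemma closedin_zariski: "closedin zariski Z \<longleftrightarrow> (\<exists>S. Z = zero_locus S)"
  by (auto simp: closedin_def openin_zariski)


section \<open>Dimension and codimension\<close>

definition irreducible_closedin :: "'a topology \<Rightarrow> 'a set \<Rightarrow> bool" where
  "irreducible_closedin X Y \<longleftrightarrow> closedin X Y \<and> Y \<noteq> {} \<and>
     (\<forall>A B. closedin X A \<and> closedin X B \<and> Y \<subseteq> A \<union> B \<longrightarrow> Y \<subseteq> A \<or> Y \<subseteq> B)"

text \<open>A chain of length \<open>m\<close> is \<open>C 0 \<subset> C 1 \<subset> \<dots> \<subset> C m\<close>; the values of \<open>C\<close> beyond \<open>m\<close>
  are irrelevant.\<close>

definition irreducible_chain :: "'a topology \<Rightarrow> nat \<Rightarrow> (nat \<Rightarrow> 'a set) \<Rightarrow> bool" where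
  "irreducible_chain X m C \<longleftrightarrow>
     (\<forall>i\<le>m. irreducible_closedin X (C i)) \<and> (\<forall>i<m. C i \<subset> C (Suc i))"

text \<open>The supremum of the empty set is \<open>0\<close> in \<^typ>\<open>enat\<close>, so the empty space gets dimension
  \<open>0\<close> instead of the more customary \<open>-1\<close> or \<open>-\<infinity>\<close>.\<close>

definition krull_dim :: "'a topology \<Rightarrow> enat" where
  "krull_dim X = Sup {enat m |m. \<exists>C. irreducible_chain X m C}"

text \<open>The codimension of an arbitrary closed subset is the infimum of the codimensions of its
  irreducible closed subsets; in particular the empty set has codimension \<open>\<infinity>\<close>.\<close>

definition codim_irreducible :: "'a topology \<Rightarrow> 'a set \<Rightarrow> enat" where
  "codim_irreducible X Y = Sup {enat m |m. \<exists>C. irreducible_chain X m C \<and> C 0 = Y}"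

definition codim_in :: "'a topology \<Rightarrow> 'a set \<Rightarrow> enat" where
  "codim_in X Z = Inf {codim_irreducible X Y |Y. irreducible_closedin X Y \<and> Y \<subseteq> Z}"


section \<open>Cones and the strong separation property\<close>

definition closed_affine_cone :: "('k::field ^ 'n::finite) set \<Rightarrow> bool" where
  "closed_affine_cone X \<longleftrightarrow> closedin zariski X \<and> (\<forall>c. \<forall>x\<in>X. c *s x \<in> X)"

definition strong_separation_property :: "('k::field ^ 'n::finite) set \<Rightarrow> bool" where
  "strong_separation_property X \<longleftrightarrow>
     closed_affine_cone X \<and> krull_dim (subtopology zariski X) \<ge> 2 \<and>
     (\<forall>W. vec.subspace W \<and> vec.dim W + 2 = CARD('n) \<longrightarrow>
        codim_in (subtopology zariski X) (W \<inter> X) = 2)"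


section \<open>Tori and their characters\<close>

text \<open>The torus of rank \<open>r = CARD('r)\<close> is \<open>(k\<^sup>*)\<^sup>r\<close>. Its character lattice is identified
  with \<open>\<int>\<^sup>r\<close>, the vector \<open>a\<close> corresponding to the Laurent monomial with exponents \<open>a\<close>; the
  lemmas \<open>regular_hom_iff_torus_char\<close>, \<open>torus_char_eq_iff\<close> and \<open>torus_char_add\<close> below say that
  this is an isomorphism of \<open>\<int>\<^sup>r\<close> onto the group of regular homomorphisms from the torus to
  \<open>k\<^sup>*\<close>.\<close>

definition torus :: "('k::field ^ 'r::finite) set" where
  "torus = {t. \<forall>i. t $ i \<noteq> 0}"

definition torus_char :: "int ^ 'r::finite \<Rightarrow> 'k::field ^ 'r \<Rightarrow> 'k" where
  "torus_char a t = (\<Prod>i\<in>UNIV. (t $ i) powi (a $ i))"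

definition torus_action ::
  "('n::finite \<Rightarrow> int ^ 'r::finite) \<Rightarrow> 'k::field ^ 'r \<Rightarrow> 'k ^ 'n \<Rightarrow> 'k ^ 'n" where
  "torus_action w t x = (\<chi> j. torus_char (w j) t * x $ j)"

definition torus_orbit ::
  "('n::finite \<Rightarrow> int ^ 'r::finite) \<Rightarrow> 'k::field ^ 'n \<Rightarrow> ('k ^ 'n) set" where
  "torus_orbit w x = (\<lambda>t. torus_action w t x) ` torus"

text \<open>Linear independence as a family in \<open>\<int>\<^sup>r \<otimes> \<rat> = \<rat>\<^sup>r\<close>: a repeated character makes the
  family dependent, hence the injectivity.\<close>

definition rat_weight :: "int ^ 'r::finite \<Rightarrow> rat ^ 'r" where
  "rat_weight a = (\<chi> i. of_int (a $ i))"

definition independent_weights :: "('n \<Rightarrow> int ^ 'r::finite) \<Rightarrow> bool" where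
  "independent_weights w \<longleftrightarrow>
     inj (\<lambda>j. rat_weight (w j)) \<and> vec.independent (range (\<lambda>j. rat_weight (w j)))"

text \<open>The coordinate ring of the torus is the polynomial ring localised at the product of the
  variables.\<close>

definition regular_on_torus :: "('k::field ^ 'r::finite \<Rightarrow> 'k) \<Rightarrow> bool" where
  "regular_on_torus f \<longleftrightarrow>
     (\<exists>p N. \<forall>t\<in>torus. f t = eval_mpoly p t / (\<Prod>i\<in>UNIV. t $ i) ^ N)"

definition multiplicative_on_torus :: "('k::field ^ 'r::finite \<Rightarrow> 'k) \<Rightarrow> bool" where
  "multiplicative_on_torus f \<longleftrightarrow>
     (\<forall>s\<in>torus. f s \<noteq> 0) \<and> (\<forall>s\<in>torus. \<forall>t\<in>torus. f (s * t) = f s * f t)"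

lemma torus_mult: "s \<in> torus \<Longrightarrow> t \<in> torus \<Longrightarrow> s * t \<in> torus"
  by (simp add: torus_def)

lemma torus_one: "1 \<in> torus"
  by (simp add: torus_def)

lemma torus_char_nonzero: "t \<in> torus \<Longrightarrow> torus_char a t \<noteq> 0"
  by (simp add: torus_def torus_char_def)

lemma torus_char_mult: "torus_char a (s * t) = torus_char a s * torus_char a t"
  by (simp add: torus_char_def power_int_mult_distrib prod.distrib)

lemma torus_char_add:
  "t \<in> torus \<Longrightarrow> torus_char (a + b) t = torus_char a t * torus_char b t"
  by (simp add: torus_char_def torus_def power_int_add prod.distrib)

lemma multiplicative_torus_char:
  "multiplicative_on_torus (torus_char a :: 'k::field ^ 'r::finite \<Rightarrow> 'k)"
  by (simp add: multiplicative_on_torus_def torus_char_nonzero torus_char_mult)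

lemma power_int_trivial_imp_zero:
  assumes "\<And>x::'k::alg_closed_field. x \<noteq> 0 \<Longrightarrow> x powi m = 1"
  shows "m = 0"
proof (rule ccontr)
  assume "m \<noteq> 0"
  define n where "n = nat \<bar>m\<bar>"
  have n: "n > 0"
    using \<open>m \<noteq> 0\<close> by (simp add: n_def)
  have pow: "x ^ n = 1" if "x \<noteq> 0" for x :: 'k
    using assms[OF that] that
    by (cases "m \<ge> 0") (auto simp: n_def power_int_def field_simps)
  define p :: "'k poly" where "p = monom 1 (Suc n) + [:1, -1:]"
  have "degree p = Suc n"
    unfolding p_def by (subst degree_add_eq_left) (use n in \<open>auto simp: degree_monom_eq\<close>)
  then obtain x where "poly p x = 0"
    using alg_closed_imp_poly_has_root[of p] by auto
  then have x: "x * x ^ n - x + 1 = 0"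
    by (simp add: p_def poly_monom algebra_simps)
  then have "x \<noteq> 0"
    by auto
  then show False
    using x pow[of x] by simp
qed

lemma torus_char_eq_iff:
  fixes a b :: "int ^ 'r::finite"
  shows "(\<forall>t\<in>torus :: ('k::alg_closed_field ^ 'r) set. torus_char a t = torus_char b t) \<longleftrightarrow> a = b"
proof
  assume eq: "\<forall>t\<in>torus :: ('k ^ 'r) set. torus_char a t = torus_char b t"
  have "a $ i - b $ i = 0" for i
  proof (rule power_int_trivial_imp_zero)
    fix x :: 'k
    assume x: "x \<noteq> 0"
    define t :: "'k ^ 'r" where "t = (\<chi> j. if j = i then x else 1)"
    have t: "t \<in> torus"
      using x by (simp add: t_def torus_def)
    have char: "torus_char c t = x powi (c $ i)" for c :: "int ^ 'r"
    proof -
      have "torus_char c t = (\<Prod>j\<in>UNIV. if j = i then x powi (c $ i) else 1)"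
        unfolding torus_char_def t_def by (intro prod.cong) auto
      then show ?thesis
        by simp
    qed
    have "x powi (a $ i) = x powi (b $ i)"
      using eq t by (metis char)
    then show "x powi (a $ i - b $ i) = 1"
      using x by (simp add: power_int_diff)
  qed
  then show "a = b"
    by (simp add: vec_eq_iff)
qed simp

lemma multiplicative_linear_independent:
  fixes S :: "('k::field ^ 'r::finite \<Rightarrow> 'k) set"
  assumes "finite S" "\<And>f. f \<in> S \<Longrightarrow> multiplicative_on_torus f"
    and "\<And>f g. f \<in> S \<Longrightarrow> g \<in> S \<Longrightarrow> f \<noteq> g \<Longrightarrow> \<exists>t\<in>torus. f t \<noteq> g t"
    and "\<And>t. t \<in> torus \<Longrightarrow> (\<Sum>f\<in>S. c f * f t) = 0"
    and "f \<in> S"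
  shows "c f = 0"
  using assms
proof (induction S arbitrary: c f rule: finite_induct)
  case (insert g S)
  have zero: "c f = 0" if f: "f \<in> S" for f
  proof -
    have "f \<noteq> g"
      using f insert.hyps by auto
    then obtain s where s: "s \<in> torus" "f s \<noteq> g s"
      using insert.prems(2)[of f g] f by auto
    have "c f * (f s - g s) = 0"
    proof (rule insert.IH[where c = "\<lambda>h. c h * (h s - g s)" and f = f])
      fix t :: "'k ^ 'r"
      assume t: "t \<in> torus"
      have mult: "h (s * t) = h s * h t" if "h \<in> insert g S" for h
        using insert.prems(1)[OF that] s t by (simp add: multiplicative_on_torus_def)
      have "c g * (g s * g t) + (\<Sum>h\<in>S. c h * (h s * h t)) = 0"
      proof -
        have "(\<Sum>h\<in>S. c h * (h s * h t)) = (\<Sum>h\<in>S. c h * h (s * t))"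
          by (intro sum.cong refl) (simp only: mult insertI2)
        then show ?thesis
          using insert.prems(3)[OF torus_mult[OF s(1) t]] insert.hyps mult[of g] by simp
      qed
      moreover have "c g * (g s * g t) + g s * (\<Sum>h\<in>S. c h * h t) =
          g s * (c g * g t + (\<Sum>h\<in>S. c h * h t))"
        by (simp add: distrib_left)
      moreover have "\<dots> = 0"
        using insert.prems(3)[OF t] insert.hyps by simp
      ultimately have "c g * (g s * g t) + (\<Sum>h\<in>S. c h * (h s * h t)) =
          c g * (g s * g t) + g s * (\<Sum>h\<in>S. c h * h t)"
        by (simp only:)
      then have "(\<Sum>h\<in>S. c h * (h s * h t)) = g s * (\<Sum>h\<in>S. c h * h t)"
        by (rule add_left_imp_eq)
      moreover have "(\<Sum>h\<in>S. c h * (h s - g s) * h t) =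
          (\<Sum>h\<in>S. c h * (h s * h t)) - g s * (\<Sum>h\<in>S. c h * h t)"
        by (simp add: sum_distrib_left sum_subtractf algebra_simps)
      ultimately show "(\<Sum>h\<in>S. c h * (h s - g s) * h t) = 0"
        by simp
    next
      show "multiplicative_on_torus h" if "h \<in> S" for h
        using insert.prems(1) that by blast
      show "\<exists>t\<in>torus. h t \<noteq> h' t" if "h \<in> S" "h' \<in> S" "h \<noteq> h'" for h h'
        using insert.prems(2) that by blast
    qed (rule f)
    then show ?thesis
      using s by simp
  qed
  have "c g * g 1 = 0"
    using insert.prems(3)[OF torus_one] insert.hyps zero by simp
  moreover have "g 1 \<noteq> 0"
    using insert.prems(1)[of g] torus_one by (auto simp: multiplicative_on_torus_def)
  ultimately show ?case
    using zero insert.prems(4) by auto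
qed simp

lemma regular_torus_char:
  "regular_on_torus (torus_char a :: 'k::field ^ 'r::finite \<Rightarrow> 'k)"
proof -
  define N where "N = nat (\<Sum>i\<in>UNIV. \<bar>a $ i\<bar>)"
  define m where "m = Abs_poly_mapping (\<lambda>i. nat (a $ i + int N))"
  have m: "Poly_Mapping.lookup m i = nat (a $ i + int N)" for i
    by (simp add: m_def)
  have N: "a $ i + int N \<ge> 0" for i
  proof -
    have "\<bar>a $ i\<bar> \<le> (\<Sum>i\<in>UNIV. \<bar>a $ i\<bar>)"
      by (rule member_le_sum) auto
    then show ?thesis
      by (simp add: N_def)
  qed
  have "torus_char a t = eval_mpoly (Poly_Mapping.single m 1) t / (\<Prod>i\<in>UNIV. t $ i) ^ N"
    if t: "t \<in> torus" for t :: "'k ^ 'r"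
  proof -
    have "(t $ i) ^ nat (a $ i + int N) = (t $ i) powi (a $ i) * (t $ i) ^ N" for i
    proof -
      have "(t $ i) ^ nat (a $ i + int N) = (t $ i) powi (a $ i + int N)"
        using N[of i] by (simp add: power_int_def)
      then show ?thesis
        using t by (simp add: torus_def power_int_add)
    qed
    then have "eval_mpoly (Poly_Mapping.single m 1) t = torus_char a t * (\<Prod>i\<in>UNIV. t $ i) ^ N"
      by (simp add: eval_mpoly_single m torus_char_def prod.distrib prod_power_distrib)
    then show ?thesis
      using t by (simp add: torus_def)
  qed
  then show ?thesis
    unfolding regular_on_torus_def by blast
qed

lemma regular_hom_iff_torus_char:
  fixes f :: "'k::field ^ 'r::finite \<Rightarrow> 'k"
  shows "regular_on_torus f \<and> multiplicative_on_torus f \<longleftrightarrow>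
    (\<exists>a. \<forall>t\<in>torus. f t = torus_char a t)"
proof
  assume "\<exists>a. \<forall>t\<in>torus. f t = torus_char a t"
  then obtain a where a: "\<And>t. t \<in> torus \<Longrightarrow> f t = torus_char a t"
    by blast
  show "regular_on_torus f \<and> multiplicative_on_torus f"
    using regular_torus_char[of a, where 'k = 'k] multiplicative_torus_char[of a, where 'k = 'k]
    by (simp add: regular_on_torus_def multiplicative_on_torus_def a torus_mult)
next
  assume f: "regular_on_torus f \<and> multiplicative_on_torus f"
  then obtain p N where p: "\<And>t. t \<in> torus \<Longrightarrow> f t = eval_mpoly p t / (\<Prod>i\<in>UNIV. t $ i) ^ N"
    unfolding regular_on_torus_def by blast
  define e :: "('r \<Rightarrow>\<^sub>0 nat) \<Rightarrow> int ^ 'r"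
    where "e m = (\<chi> i. int (Poly_Mapping.lookup m i) - int N)" for m
  have e: "torus_char (e m) t =
      (\<Prod>i\<in>UNIV. (t $ i) ^ Poly_Mapping.lookup m i) / (\<Prod>i\<in>UNIV. t $ i) ^ N"
    if "t \<in> torus" for m and t :: "'k ^ 'r"
    using that by (simp add: torus_char_def e_def torus_def power_int_diff prod_dividef
        prod_power_distrib)
  define res :: "('k ^ 'r \<Rightarrow> 'k) \<Rightarrow> 'k ^ 'r \<Rightarrow> 'k" where "res h = restrict h torus" for h
  define R where "R m = res (torus_char (e m))" for m
  define K where "K = Poly_Mapping.keys p"
  have f_eq: "f t = (\<Sum>m\<in>K. Poly_Mapping.lookup p m * R m t)" if "t \<in> torus" for t
    using that by (simp add: p R_def res_def e eval_mpoly_def K_def sum_divide_distrib)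
  show "\<exists>a. \<forall>t\<in>torus. f t = torus_char a t"
  proof (rule ccontr)
    assume no: "\<nexists>a. \<forall>t\<in>torus. f t = torus_char a t"
    have notin: "res f \<notin> R ` K"
    proof
      assume "res f \<in> R ` K"
      then obtain m where "res f = R m"
        by blast
      then have "f t = torus_char (e m) t" if "t \<in> torus" for t
        using that by (metis R_def res_def restrict_apply')
      then show False
        using no by blast
    qed
    have ne: "R m \<noteq> res f" if "m \<in> K" for m
      using notin that by (metis imageI)
    define c where "c h = (if h = res f then -1 else
      (\<Sum>m | m \<in> K \<and> R m = h. Poly_Mapping.lookup p m))" for h
    have fin: "finite K"
      by (simp add: K_def)
    have "c (res f) = 0"
    proof (rule multiplicative_linear_independent[of "insert (res f) (R ` K)" c "res f"])
      fix h
      assume "h \<in> insert (res f) (R ` K)"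
      then obtain h' where "h = res h'" "multiplicative_on_torus h'"
        using f multiplicative_torus_char by (auto simp: R_def)
      then show "multiplicative_on_torus h"
        by (simp add: res_def multiplicative_on_torus_def torus_mult)
    next
      fix h h'
      assume "h \<in> insert (res f) (R ` K)" "h' \<in> insert (res f) (R ` K)" "h \<noteq> h'"
      then have "h \<in> extensional torus" "h' \<in> extensional torus"
        by (auto simp: R_def res_def)
      then show "\<exists>t\<in>torus. h t \<noteq> h' t"
        using \<open>h \<noteq> h'\<close> by (metis extensionalityI)
    next
      fix t :: "'k ^ 'r"
      assume t: "t \<in> torus"
      have "(\<Sum>h\<in>R ` K. c h * h t) =
          (\<Sum>h\<in>R ` K. \<Sum>m | m \<in> K \<and> R m = h. Poly_Mapping.lookup p m * R m t)"
        by (intro sum.cong refl) (auto simp: c_def ne sum_distrib_right)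
      also have "\<dots> = f t"
        using f_eq[OF t] sum.image_gen[OF fin, of "\<lambda>m. Poly_Mapping.lookup p m * R m t" R] by simp
      finally show "(\<Sum>h\<in>insert (res f) (R ` K). c h * h t) = 0"
        using notin fin t by (simp add: c_def res_def)
    qed (use fin in auto)
    then show False
      by (simp add: c_def)
  qed
qed

end

theory Submission
  imports Defs
begin

text \<open>
  Dimensions are measured by algebraically independent polynomial functions: each step of a chain of
  irreducible closed sets yields one more of them, and on the orbit of \<open>1\<close> there are at most as many
  as the rank of the weights, because the monomials of degree at most \<open>K\<close> restrict to only
  polynomially many characters. By Dedekind's theorem the closure is the whole space iff the weights
  are independent, and affine space has (SSP) by the dimension bound.

  Conversely, a cone has its weights on an affine hyperplane. If \<open>\<Sum> c\<^sub>j \<chi>\<^sub>j = 0\<close> with \<open>c\<^sub>p \<noteq> 0\<close>, take a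
  facet of the cone spanned by the weights that does not contain \<open>\<chi>\<^sub>p\<close>. Evaluating its supporting
  functional on the relation shows that it misses another \<open>\<chi>\<^sub>q\<close> with \<open>q \<noteq> p\<close>. The orbit closure that
  belongs to the facet then has codimension at most \<open>1\<close> in \<open>X\<close>, but is contained in
  \<open>x\<^sub>p = x\<^sub>q = 0\<close>.
\<close>

section \<open>Zariski closed and irreducible sets\<close>

text \<open>Codimension is defined by chains, and the dimension of \<open>X\<close> is never
  computed. It is enough to compare two counts: if \<open>Y\<close> carries \<open>d\<close>
  independent functions and \<open>X\<close> carries at most \<open>d + m\<close>, then no chain in
  \<open>X\<close> that starts at \<open>Y\<close> is longer than \<open>m\<close>. The lower count
  comes from explicit functions on \<open>Y\<close>, the upper one from linear algebra on the orbit.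
  Since \<open>codim_in\<close> is an infimum, a single irreducible \<open>Y\<close> inside
  \<open>W \<inter> X\<close> refutes (SSP).

  The cone property enters as homogeneity: the coefficients of every relation between the weights
  add up to 0. Dually, some functional equals 1 on all weights, so they generate a strictly convex
  cone, and this is why a facet avoiding a given weight exists. For the weights 1 and -1 of a torus
  of rank one, whose orbit closure is the hyperbola xy = 1, there is no such facet.

  Faces are found over the rationals, while characters and one-parameter subgroups need integers;
  hence the recurring common denominator \<open>M\<close>.\<close>

lemma eval_mpoly_power: "eval_mpoly (p ^ m) x = eval_mpoly p x ^ m"
  by (induction m) (simp_all add: eval_mpoly_mult)

lemma eval_mpoly_prod: "eval_mpoly (\<Prod>a\<in>A. f a) x = (\<Prod>a\<in>A. eval_mpoly (f a) x)"
  by (induction A rule: infinite_finite_induct) (simp_all add: eval_mpoly_mult)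

lemma eval_mpoly_const: "eval_mpoly (Poly_Mapping.single 0 c) x = c"
  by (simp add: eval_mpoly_single)

lemma eval_mpoly_uminus: "eval_mpoly (- p) x = - eval_mpoly p x"
  using eval_mpoly_add[of p "- p" x] by (simp add: eq_neg_iff_add_eq_0 add.commute)

lemma eval_mpoly_diff: "eval_mpoly (p - q) x = eval_mpoly p x - eval_mpoly q x"
  using eval_mpoly_add[of p "- q" x] by (simp add: eval_mpoly_uminus)

definition mvar :: "'n \<Rightarrow> ('n, 'k::zero_neq_one) mpoly" where
  "mvar i = Poly_Mapping.single (Poly_Mapping.single i 1) 1"

lemma eval_mpoly_mvar [simp]: "eval_mpoly (mvar i) x = x $ i"
proof -
  have "(\<Prod>j\<in>UNIV. x $ j ^ Poly_Mapping.lookup (Poly_Mapping.single i 1) j) =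
      (\<Prod>j\<in>UNIV. if j = i then x $ i else 1)"
    by (intro prod.cong refl) (auto simp: lookup_single when_def)
  then show ?thesis
    by (simp add: mvar_def eval_mpoly_single)
qed

text \<open>Pulling back along a polynomial curve reduces questions about several variables to one
  variable. The curves used are lines, and limits of one-parameter subgroups.\<close>

lemma eval_mpoly_poly_curve:
  fixes p :: "('n::finite, 'k::field) mpoly"
  shows "\<exists>Q. \<forall>s. eval_mpoly p (\<chi> j. poly (q j) s) = poly Q s"
proof (intro exI allI)
  show "eval_mpoly p (\<chi> j. poly (q j) s) =
      poly (\<Sum>m\<in>Poly_Mapping.keys p. smult (Poly_Mapping.lookup p m)
        (\<Prod>j\<in>UNIV. q j ^ Poly_Mapping.lookup m j)) s" for s
    by (simp add: eval_mpoly_def poly_sum poly_prod poly_power)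
qed

lemma closedin_zariski_zeros: "closedin zariski {x. eval_mpoly p x = 0}"
  unfolding closedin_zariski by (rule exI[of _ "{p}"]) (auto simp: zero_locus_def)

lemma zariski_separates_point:
  assumes "closedin zariski Z" "x \<notin> Z"
  obtains p where "\<And>z. z \<in> Z \<Longrightarrow> eval_mpoly p z = 0" "eval_mpoly p x \<noteq> 0"
  using assms unfolding closedin_zariski zero_locus_def by blast

lemma eval_mpoly_zero_on_closure:
  assumes "\<And>x. x \<in> S \<Longrightarrow> eval_mpoly p x = 0" "x \<in> zariski closure_of S"
  shows "eval_mpoly p x = 0"
proof -
  have "zariski closure_of S \<subseteq> {x. eval_mpoly p x = 0}"
    by (rule closure_of_minimal) (use assms(1) closedin_zariski_zeros in auto)
  then show ?thesis
    using assms(2) by blast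
qed

lemma in_zariski_closure_iff:
  "x \<in> zariski closure_of S \<longleftrightarrow> (\<forall>p. (\<forall>y\<in>S. eval_mpoly p y = 0) \<longrightarrow> eval_mpoly p x = 0)"
proof
  assume *: "\<forall>p. (\<forall>y\<in>S. eval_mpoly p y = 0) \<longrightarrow> eval_mpoly p x = 0"
  show "x \<in> zariski closure_of S"
  proof (rule ccontr)
    assume "x \<notin> zariski closure_of S"
    then obtain p where "\<And>z. z \<in> zariski closure_of S \<Longrightarrow> eval_mpoly p z = 0" "eval_mpoly p x \<noteq> 0"
      using zariski_separates_point[OF closedin_closure_of] by metis
    moreover have "S \<subseteq> zariski closure_of S"
      by (rule closure_of_subset) simp
    ultimately show False
      using * by blast
  qed
qed (use eval_mpoly_zero_on_closure in blast)

lemma poly_eq_zero_if_zero_on_units: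
  fixes Q :: "'k::alg_closed_field poly"
  assumes "\<And>s. s \<noteq> 0 \<Longrightarrow> poly Q s = 0"
  shows "Q = 0"
proof -
  \<comment> \<open>\<open>R\<close> is 1 + X Q. The factor X makes it take the value 1 at 0 as
    well, so \<open>R\<close> has no root and must be constant over an algebraically closed
    field.\<close>
  define R where "R = pCons 0 Q + 1"
  have R1: "poly R s = 1" for s
    using assms[of s] by (cases "s = 0") (simp_all add: R_def)
  have "degree R = 0"
    using alg_closed_imp_poly_has_root[of R] R1 by fastforce
  then have "R = 1"
    using R1[of 0] by (metis degree_0_id of_nat_1 poly_0_coeff_0 pCons_one)
  then show ?thesis
    by (simp add: R_def)
qed

text \<open>The third hypothesis says that the coordinate ring of \<open>Y\<close> has no zero
  divisors. Applied to functions that vanish on \<open>A\<close> and \<open>B\<close> but not on all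
  of \<open>Y\<close>, it contradicts the covering.\<close>

lemma irreducible_closedin_zariskiI:
  assumes "closedin zariski Y" "Y \<noteq> {}"
    and "\<And>p q x y. x \<in> Y \<Longrightarrow> y \<in> Y \<Longrightarrow> eval_mpoly p x \<noteq> 0 \<Longrightarrow> eval_mpoly q y \<noteq> 0 \<Longrightarrow>
      \<exists>z\<in>Y. eval_mpoly p z \<noteq> 0 \<and> eval_mpoly q z \<noteq> 0"
  shows "irreducible_closedin zariski Y"
  unfolding irreducible_closedin_def
proof (intro conjI allI impI assms(1,2))
  fix A B
  assume AB: "closedin zariski A \<and> closedin zariski B \<and> Y \<subseteq> A \<union> B"
  show "Y \<subseteq> A \<or> Y \<subseteq> B"
  proof (rule ccontr)
    assume "\<not> (Y \<subseteq> A \<or> Y \<subseteq> B)"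
    then obtain x y where xy: "x \<in> Y" "x \<notin> A" "y \<in> Y" "y \<notin> B"
      by blast
    obtain p where p: "\<And>z. z \<in> A \<Longrightarrow> eval_mpoly p z = 0" "eval_mpoly p x \<noteq> 0"
      using zariski_separates_point[of A x] AB xy by metis
    obtain q where q: "\<And>z. z \<in> B \<Longrightarrow> eval_mpoly q z = 0" "eval_mpoly q y \<noteq> 0"
      using zariski_separates_point[of B y] AB xy by metis
    obtain z where "z \<in> Y" "eval_mpoly p z \<noteq> 0" "eval_mpoly q z \<noteq> 0"
      using assms(3)[OF xy(1,3) p(2) q(2)] by blast
    then show False
      using p(1) q(1) AB by blast
  qed
qed

text \<open>Restricting to the line through the two points reduces this to polynomials in one
  variable.\<close>

lemma subspace_common_nonzero:
  fixes p q :: "('n::finite, 'k::alg_closed_field) mpoly"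
  assumes "vec.subspace W" "x \<in> W" "y \<in> W" "eval_mpoly p x \<noteq> 0" "eval_mpoly q y \<noteq> 0"
  shows "\<exists>z\<in>W. eval_mpoly p z \<noteq> 0 \<and> eval_mpoly q z \<noteq> 0"
proof (rule ccontr)
  assume no: "\<not> ?thesis"
  let ?l = "\<lambda>s. (\<chi> j. poly [:x $ j, y $ j - x $ j:] s)"
  have l: "?l s = x + s *s (y - x)" for s
    by (simp add: vec_eq_iff right_diff_distrib)
  obtain P where P: "\<And>s. eval_mpoly p (?l s) = poly P s"
    using eval_mpoly_poly_curve[of p "\<lambda>j. [:x $ j, y $ j - x $ j:]"] by blast
  obtain Q where Q: "\<And>s. eval_mpoly q (?l s) = poly Q s"
    using eval_mpoly_poly_curve[of q "\<lambda>j. [:x $ j, y $ j - x $ j:]"] by blast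
  have W: "?l s \<in> W" for s
    unfolding l using assms(1-3) by (intro vec.subspace_add vec.subspace_scale vec.subspace_diff)
  have "poly (P * Q) s = 0" for s
  proof -
    have "eval_mpoly p (?l s) = 0 \<or> eval_mpoly q (?l s) = 0"
      using no W[of s] by blast
    then show ?thesis
      unfolding P Q by auto
  qed
  then have "P * Q = 0"
    by (intro poly_eq_zero_if_zero_on_units)
  moreover have "poly P 0 \<noteq> 0" "poly Q 1 \<noteq> 0"
    unfolding P[symmetric] Q[symmetric] l using assms(4,5) by simp_all
  ultimately show False
    by auto
qed

section \<open>Separation by linear functionals; linear subspaces are closed and irreducible\<close>

lemma closedin_zariski_hyperplane_Inter:
  "closedin zariski {x :: 'k::field ^ 'n::finite. \<forall>i\<in>I. (\<Sum>j\<in>UNIV. a i j * x $ j) = 0}"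
proof -
  let ?p = "\<lambda>i. \<Sum>j\<in>UNIV. Poly_Mapping.single 0 (a i j) * mvar j"
  have "{x. \<forall>i\<in>I. (\<Sum>j\<in>UNIV. a i j * x $ j) = 0} = zero_locus (?p ` I)"
    by (auto simp: zero_locus_def eval_mpoly_sum eval_mpoly_mult eval_mpoly_const)
  then show ?thesis
    unfolding closedin_zariski by blast
qed

text \<open>A linear map that kills a basis of the span of \<open>S\<close> and fixes
  \<open>x\<close> exists because \<open>x\<close> is independent of that basis. The functional is a
  row of its matrix at which \<open>x\<close> has a nonzero coordinate. It serves over
  \<open>k\<close> for subspaces and over the rationals for weights.\<close>

lemma linear_separates_point:
  fixes S :: "('k::field ^ 'm::finite) set"
  assumes "x \<notin> vec.span S"
  shows "\<exists>u. (\<forall>y\<in>S. scalar_product u y = 0) \<and> scalar_product u x \<noteq> 0"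
proof -
  obtain B where B: "B \<subseteq> S" "vec.independent B" "S \<subseteq> vec.span B"
    by (rule vec.basis_exists)
  have xB: "x \<notin> vec.span B"
    using B assms vec.span_mono by blast
  then have "vec.independent (insert x B)"
    using B(2) by (simp add: vec.independent_insertI)
  then obtain g where g: "Vector_Spaces.linear (*s) (*s) g"
      "\<And>b. b \<in> insert x B \<Longrightarrow> g b = (if b = x then x else 0)"
    using vec.linear_independent_extend[of "insert x B" "\<lambda>b. if b = x then x else 0"] by blast
  have "x \<noteq> 0"
    using xB vec.span_zero[of B] by metis
  then obtain i where i: "x $ i \<noteq> 0"
    by (auto simp: vec_eq_iff)
  have row: "scalar_product (matrix g $ i) y = g y $ i" for y
  proof -
    have "(matrix g *v y) $ i = g y $ i"
      using matrix_works[OF g(1), of y] by simp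
    then show ?thesis
      by (simp add: matrix_vector_mult_def scalar_product_def)
  qed
  have "g y = 0" if "y \<in> S" for y
  proof -
    have "y \<in> vec.span B"
      using that B(3) by blast
    moreover have "vec.subspace {y. g y = 0}"
      using g(1) by (rule vec.linear_subspace_kernel)
    moreover have "B \<subseteq> {y. g y = 0}"
    proof
      fix b assume "b \<in> B"
      moreover from this have "b \<noteq> x"
        using xB vec.span_base by metis
      ultimately show "b \<in> {y. g y = 0}"
        using g(2)[of b] by simp
    qed
    ultimately show ?thesis
      using vec.span_minimal by blast
  qed
  then have "(\<forall>y\<in>S. scalar_product (matrix g $ i) y = 0) \<and> scalar_product (matrix g $ i) x \<noteq> 0"
    using row g(2)[of x] i by simp
  then show ?thesis
    by (rule exI)
qed

lemma closedin_zariski_subspace: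
  assumes "vec.subspace (W :: ('k::field ^ 'n::finite) set)"
  shows "closedin zariski W"
proof -
  have "W = {x. \<forall>u\<in>{u. \<forall>y\<in>W. scalar_product u y = 0}. (\<Sum>j\<in>UNIV. u $ j * x $ j) = 0}"
    (is "_ = ?R")
  proof (intro equalityI subsetI)
    fix x assume x: "x \<in> ?R"
    show "x \<in> W"
    proof (rule ccontr)
      assume "x \<notin> W"
      then have "x \<notin> vec.span W"
        using assms by (simp add: vec.span_eq_iff[THEN iffD2])
      then obtain u where u: "\<forall>y\<in>W. scalar_product u y = 0" "scalar_product u x \<noteq> 0"
        using linear_separates_point by blast
      then show False
        using x by (simp add: scalar_product_def)
    qed
  qed (auto simp: scalar_product_def)
  also have "closedin zariski \<dots>"
    by (rule closedin_zariski_hyperplane_Inter)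
  finally show ?thesis .
qed

lemma irreducible_closedin_subspace:
  assumes "vec.subspace (W :: ('k::alg_closed_field ^ 'n::finite) set)"
  shows "irreducible_closedin zariski W"
proof (rule irreducible_closedin_zariskiI)
  show "W \<noteq> {}"
    using vec.subspace_0[OF assms] by blast
qed (use closedin_zariski_subspace[OF assms] subspace_common_nonzero[OF assms] in blast)+

lemma irreducible_closedin_subtopology_iff:
  assumes X: "closedin T X"
  shows "irreducible_closedin (subtopology T X) Y \<longleftrightarrow> irreducible_closedin T Y \<and> Y \<subseteq> X"
proof
  assume irr: "irreducible_closedin (subtopology T X) Y"
  then have Y: "closedin T Y" "Y \<noteq> {}" "Y \<subseteq> X"
    by (simp_all add: irreducible_closedin_def closedin_closed_subtopology[OF X])
  have "Y \<subseteq> A \<or> Y \<subseteq> B" if "closedin T A" "closedin T B" "Y \<subseteq> A \<union> B" for A B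
  proof -
    have "closedin (subtopology T X) (A \<inter> X)" "closedin (subtopology T X) (B \<inter> X)"
      using that X by (simp_all add: closedin_closed_subtopology[OF X] closedin_Int)
    moreover have "Y \<subseteq> (A \<inter> X) \<union> (B \<inter> X)"
      using that Y by blast
    ultimately have "Y \<subseteq> A \<inter> X \<or> Y \<subseteq> B \<inter> X"
      using irr[unfolded irreducible_closedin_def, THEN conjunct2, THEN conjunct2,
          THEN spec[of _ "A \<inter> X"], THEN spec[of _ "B \<inter> X"]] by blast
    then show ?thesis
      by blast
  qed
  then show "irreducible_closedin T Y \<and> Y \<subseteq> X"
    using Y by (simp add: irreducible_closedin_def)
qed (simp add: irreducible_closedin_def closedin_closed_subtopology[OF X])

lemma irreducible_chain_subtopology_iff:
  assumes "closedin T X"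
  shows "irreducible_chain (subtopology T X) m C \<longleftrightarrow> irreducible_chain T m C \<and> (\<forall>i\<le>m. C i \<subseteq> X)"
  by (auto simp: irreducible_chain_def irreducible_closedin_subtopology_iff[OF assms])

section \<open>Algebraic independence and chains\<close>

text \<open>The exponent vectors are functions on all of \<open>nat\<close>; they vanish from \<open>d\<close> on.\<close>

definition algebraically_independent_on ::
  "('k::field ^ 'n::finite) set \<Rightarrow> (nat \<Rightarrow> ('n, 'k) mpoly) \<Rightarrow> nat \<Rightarrow> bool" where
  "algebraically_independent_on Y P d \<longleftrightarrow>
     (\<forall>S c. finite S \<and> (\<forall>a\<in>S. \<forall>i\<ge>d. a i = (0::nat)) \<and>
        (\<forall>x\<in>Y. (\<Sum>a\<in>S. c a * (\<Prod>i<d. eval_mpoly (P i) x ^ a i)) = 0) \<longrightarrow> (\<forall>a\<in>S. c a = 0))"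

lemma algebraically_independent_onD:
  assumes "algebraically_independent_on Y P d" "finite S" "\<And>a i. a \<in> S \<Longrightarrow> i \<ge> d \<Longrightarrow> a i = 0"
    and "\<And>x. x \<in> Y \<Longrightarrow> (\<Sum>a\<in>S. c a * (\<Prod>i<d. eval_mpoly (P i) x ^ a i)) = 0" "a \<in> S"
  shows "c a = 0"
  using assms(1)[unfolded algebraically_independent_on_def, THEN spec[of _ S], THEN spec[of _ c]]
    assms(2-5) by simp

lemma algebraically_independent_on_mono:
  assumes "algebraically_independent_on Y P d" "Y \<subseteq> Y'"
  shows "algebraically_independent_on Y' P d"
  unfolding algebraically_independent_on_def
proof (intro allI impI)
  fix S c
  assume *: "finite S \<and> (\<forall>a\<in>S. \<forall>i\<ge>d. a i = (0::nat)) \<and>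
      (\<forall>x\<in>Y'. (\<Sum>a\<in>S. c a * (\<Prod>i<d. eval_mpoly (P i) x ^ a i)) = 0)"
  show "\<forall>a\<in>S. c a = 0"
  proof
    fix a assume "a \<in> S"
    show "c a = 0"
    proof (rule algebraically_independent_onD[OF assms(1), of S c])
      show "(\<Sum>a\<in>S. c a * (\<Prod>i<d. eval_mpoly (P i) x ^ a i)) = 0" if "x \<in> Y" for x
        using * that assms(2) by blast
    qed (use * \<open>a \<in> S\<close> in simp_all)
  qed
qed

lemma algebraically_independent_on_0:
  assumes "x \<in> Y"
  shows "algebraically_independent_on Y P 0"
  unfolding algebraically_independent_on_def
proof (intro allI impI ballI)
  fix S c and a :: "nat \<Rightarrow> nat"
  assume *: "finite S \<and> (\<forall>a\<in>S. \<forall>i\<ge>0. a i = (0::nat)) \<and>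
      (\<forall>x\<in>Y. (\<Sum>a\<in>S. c a * (\<Prod>i<0. eval_mpoly (P i) x ^ a i)) = 0)" and "a \<in> S"
  then have "b = (\<lambda>_. 0)" if "b \<in> S" for b
    using that by (intro ext) simp
  then have "S = {\<lambda>_. 0}"
    using \<open>a \<in> S\<close> by blast
  then show "c a = 0"
    using * assms \<open>a \<in> S\<close> by auto
qed

text \<open>A relation involving \<open>q\<close> may be divided by the largest power of \<open>q\<close> occurring in it,
  since \<open>Y'\<close> is irreducible and \<open>q\<close> does not vanish on \<open>Y'\<close>; restricted to \<open>Y\<close> it becomes a
  relation that does not involve \<open>q\<close>.\<close>

lemma algebraically_independent_on_extend:
  assumes indep: "algebraically_independent_on Y P d" and sub: "Y \<subseteq> Y'"
    and irr: "irreducible_closedin zariski Y'"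
    and q: "\<And>y. y \<in> Y \<Longrightarrow> eval_mpoly q y = 0" "x \<in> Y'" "eval_mpoly q x \<noteq> 0"
  shows "algebraically_independent_on Y' (P(d := q)) (Suc d)"
  unfolding algebraically_independent_on_def
proof (intro allI impI, rule ccontr)
  fix S0 c
  assume *: "finite S0 \<and> (\<forall>a\<in>S0. \<forall>i\<ge>Suc d. a i = (0::nat)) \<and>
      (\<forall>x\<in>Y'. (\<Sum>a\<in>S0. c a * (\<Prod>i<Suc d. eval_mpoly ((P(d := q)) i) x ^ a i)) = 0)"
    and no: "\<not> (\<forall>a\<in>S0. c a = 0)"
  \<comment> \<open>Terms with coefficient 0 are discarded so that the smallest exponent of
    \<open>q\<close> is attained by a term that really occurs.\<close>
  define S where "S = {a \<in> S0. c a \<noteq> 0}"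
  have S: "finite S" "S \<noteq> {}" "\<And>a. a \<in> S \<Longrightarrow> c a \<noteq> 0" "\<And>a i. a \<in> S \<Longrightarrow> i \<ge> Suc d \<Longrightarrow> a i = 0"
    using * no by (auto simp: S_def)
  let ?m = "\<lambda>a x. \<Prod>i<d. eval_mpoly (P i) x ^ a i"
  have rel: "(\<Sum>a\<in>S. c a * ?m a x * eval_mpoly q x ^ a d) = 0" if "x \<in> Y'" for x
  proof -
    have "(\<Sum>a\<in>S. c a * ?m a x * eval_mpoly q x ^ a d) =
        (\<Sum>a\<in>S0. c a * (\<Prod>i<Suc d. eval_mpoly ((P(d := q)) i) x ^ a i))"
      using * by (intro sum.mono_neutral_cong_left) (auto simp: S_def mult.assoc)
    then show ?thesis
      using * that by simp
  qed
  define e where "e = Min ((\<lambda>a. a d) ` S)"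
  have e: "e \<le> a d" if "a \<in> S" for a
    using that S(1) by (simp add: e_def)
  obtain b where b: "b \<in> S" "b d = e"
    using Min_in[of "(\<lambda>a. a d) ` S"] S(1,2) unfolding e_def by fastforce
  \<comment> \<open>\<open>G\<close> is the relation divided by \<open>q ^ e\<close>, as a
    polynomial on the whole space.\<close>
  define G where "G = (\<Sum>a\<in>S. Poly_Mapping.single 0 (c a) * (\<Prod>i<d. P i ^ a i) * q ^ (a d - e))"
  have G: "eval_mpoly G x = (\<Sum>a\<in>S. c a * ?m a x * eval_mpoly q x ^ (a d - e))" for x
    by (simp add: G_def eval_mpoly_sum eval_mpoly_mult eval_mpoly_const eval_mpoly_prod
        eval_mpoly_power)
  have "eval_mpoly q x ^ e * eval_mpoly G x = 0" if "x \<in> Y'" for x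
  proof -
    have "eval_mpoly q x ^ e * eval_mpoly G x = (\<Sum>a\<in>S. c a * ?m a x * eval_mpoly q x ^ a d)"
      unfolding G sum_distrib_left
    proof (intro sum.cong refl)
      fix a assume "a \<in> S"
      then have "eval_mpoly q x ^ a d = eval_mpoly q x ^ e * eval_mpoly q x ^ (a d - e)"
        using e[of a] by (simp flip: power_add)
      then show "eval_mpoly q x ^ e * (c a * ?m a x * eval_mpoly q x ^ (a d - e)) =
          c a * ?m a x * eval_mpoly q x ^ a d"
        by (simp add: mult_ac)
    qed
    then show ?thesis
      using rel[OF that] by simp
  qed
  then have "Y' \<subseteq> {x. eval_mpoly q x = 0} \<union> {x. eval_mpoly G x = 0}"
    by auto
  then have "Y' \<subseteq> {x. eval_mpoly q x = 0} \<or> Y' \<subseteq> {x. eval_mpoly G x = 0}"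
    using irr closedin_zariski_zeros unfolding irreducible_closedin_def by blast
  then have G0: "eval_mpoly G y = 0" if "y \<in> Y" for y
    using q sub that by blast
  \<comment> \<open>On \<open>Y\<close> only the terms free of \<open>q\<close> survive in
    \<open>G\<close>, namely those with \<open>a d = e\<close>. Resetting that exponent to 0 turns
    them into exponent vectors that vanish from \<open>d\<close> on, and \<open>b\<close> witnesses
    a nonzero coefficient.\<close>
  define S' where "S' = {a \<in> S. a d = e}"
  have inj: "inj_on (\<lambda>a. a(d := 0)) S'"
  proof (rule inj_onI)
    fix a a' :: "nat \<Rightarrow> nat" assume "a \<in> S'" "a' \<in> S'" and eq: "a(d := 0) = a'(d := 0)"
    then have "a d = a' d"
      by (simp add: S'_def)
    then show "a = a'"
      using eq by (metis fun_upd_triv fun_upd_upd)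
  qed
  define c' where "c' a = c (a(d := e))" for a
  have c': "c' (a(d := 0)) = c a" if "a \<in> S'" for a
    using that by (auto simp: c'_def S'_def)
  have "c' (b(d := 0)) = 0"
  proof (rule algebraically_independent_onD[OF indep, where S = "(\<lambda>a. a(d := 0)) ` S'" and c = c'])
    show "finite ((\<lambda>a. a(d := 0)) ` S')"
      using S(1) by (simp add: S'_def)
    show "b(d := 0) \<in> (\<lambda>a. a(d := 0)) ` S'"
      using b by (auto simp: S'_def)
    show "a i = 0" if "a \<in> (\<lambda>a. a(d := 0)) ` S'" "i \<ge> d" for a i
      using that S(4) by (cases "i = d") (auto simp: S'_def)
    fix y assume y: "y \<in> Y"
    have "(\<Sum>a\<in>(\<lambda>a. a(d := 0)) ` S'. c' a * ?m a y) = (\<Sum>a\<in>S'. c a * ?m a y)"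
      by (subst sum.reindex[OF inj]) (auto intro!: sum.cong prod.cong simp: c')
    also have "\<dots> = eval_mpoly G y"
      unfolding G S'_def
    proof (rule sum.mono_neutral_cong_left)
      show "\<forall>a\<in>S - {a \<in> S. a d = e}. c a * ?m a y * eval_mpoly q y ^ (a d - e) = 0"
      proof
        fix a assume "a \<in> S - {a \<in> S. a d = e}"
        then have "a d - e > 0"
          using e[of a] by auto
        then show "c a * ?m a y * eval_mpoly q y ^ (a d - e) = 0"
          using q(1)[OF y] by simp
      qed
    qed (use S(1) in auto)
    finally show "(\<Sum>a\<in>(\<lambda>a. a(d := 0)) ` S'. c' a * ?m a y) = 0"
      using G0[OF y] by simp
  qed
  then show False
    using c'[of b] b S(3) by (simp add: S'_def)
qed

text \<open>At each strict inclusion, a polynomial separating a new point from the smaller set is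
  adjoined. Starting with \<open>d\<close> functions on \<open>C 0\<close> is what later gives
  bounds on codimension and not only on dimension.\<close>

lemma algebraically_independent_on_chain:
  assumes "irreducible_chain zariski m C" "algebraically_independent_on (C 0) P d"
  shows "\<exists>P'. algebraically_independent_on (C m) P' (d + m)"
  using assms(1)
proof (induction m)
  case (Suc m)
  then have *: "irreducible_chain zariski m C" "C m \<subset> C (Suc m)"
      "irreducible_closedin zariski (C m)" "irreducible_closedin zariski (C (Suc m))"
    by (auto simp: irreducible_chain_def)
  then obtain P' where P': "algebraically_independent_on (C m) P' (d + m)"
    using Suc.IH by blast
  obtain x where x: "x \<in> C (Suc m)" "x \<notin> C m"
    using * by blast
  obtain q where "\<And>z. z \<in> C m \<Longrightarrow> eval_mpoly q z = 0" "eval_mpoly q x \<noteq> 0"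
    using zariski_separates_point[of "C m" x] x *(3) unfolding irreducible_closedin_def by metis
  then show ?case
    using algebraically_independent_on_extend[OF P' _ *(4)] * x by fastforce
qed (use assms(2) in auto)

section \<open>Algebraic independence on torus orbits\<close>

lemma torus_char_0 [simp]: "torus_char 0 t = 1"
  by (simp add: torus_char_def)

lemma torus_char_scale: "torus_char (int m *s a) t = torus_char a t ^ m"
proof -
  have "(t $ i) powi (int m * a $ i) = ((t $ i) powi (a $ i)) ^ m" for i
    by (metis mult.commute power_int_mult power_int_of_nat)
  then show ?thesis
    by (simp add: torus_char_def prod_power_distrib)
qed

lemma torus_char_sum:
  assumes "t \<in> torus"
  shows "torus_char (\<Sum>j\<in>A. f j) t = (\<Prod>j\<in>A. torus_char (f j) t)"
  using assms by (induction A rule: infinite_finite_induct) (simp_all add: torus_char_add)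

lemma torus_char_monomial:
  assumes "t \<in> torus"
  shows "torus_char (\<Sum>j\<in>A. int (m j) *s w j) t = (\<Prod>j\<in>A. torus_char (w j) t ^ m j)"
  using assms by (simp add: torus_char_sum torus_char_scale)

text \<open>Dedekind's theorem for families. Algebraic closedness ensures that distinct exponent
  vectors are distinct functions on the torus, so coefficients can be transported between indices
  and functions.\<close>

lemma torus_chars_linear_independent:
  fixes \<phi> :: "'a \<Rightarrow> int ^ 'r::finite" and c :: "'a \<Rightarrow> 'k::alg_closed_field"
  assumes "finite E" "inj_on \<phi> E" "m \<in> E"
    and zero: "\<And>t :: 'k ^ 'r. t \<in> torus \<Longrightarrow> (\<Sum>m\<in>E. c m * torus_char (\<phi> m) t) = 0"
  shows "c m = 0"
proof -
  define g :: "'a \<Rightarrow> 'k ^ 'r \<Rightarrow> 'k" where "g m = torus_char (\<phi> m)" for m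
  have sep: "\<exists>t\<in>torus. torus_char a t \<noteq> (torus_char b t :: 'k)" if "a \<noteq> b" for a b :: "int ^ 'r"
    using torus_char_eq_iff[where 'k = 'k, of a b] that by blast
  have g_eq: "g m = g m' \<longleftrightarrow> m = m'" if "m \<in> E" "m' \<in> E" for m m'
  proof
    assume "g m = g m'"
    then have "\<phi> m = \<phi> m'"
      using sep[of "\<phi> m" "\<phi> m'"] unfolding g_def by metis
    then show "m = m'"
      using assms(2) that by (simp add: inj_on_eq_iff)
  qed simp
  have inj: "inj_on g E"
    using g_eq by (simp add: inj_on_def)
  have "c (the_inv_into E g (g m)) = 0"
  proof (rule multiplicative_linear_independent[where S = "g ` E" and f = "g m" and
        c = "\<lambda>f. c (the_inv_into E g f)"])
    show "finite (g ` E)" "g m \<in> g ` E"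
      using assms by simp_all
    show "multiplicative_on_torus f" if "f \<in> g ` E" for f
      using that multiplicative_torus_char by (auto simp: g_def)
    show "\<exists>t\<in>torus. f t \<noteq> f' t" if ff: "f \<in> g ` E" "f' \<in> g ` E" "f \<noteq> f'" for f f'
    proof -
      obtain m m' where "f = g m" "f' = g m'"
        using ff by blast
      moreover from this have "\<phi> m \<noteq> \<phi> m'"
        using ff(3) by (auto simp: g_def)
      ultimately show ?thesis
        using sep by (simp add: g_def)
    qed
    show "(\<Sum>f\<in>g ` E. c (the_inv_into E g f) * f t) = 0" if "t \<in> torus" for t
    proof -
      have "(\<Sum>f\<in>g ` E. c (the_inv_into E g f) * f t) = (\<Sum>m\<in>E. c m * torus_char (\<phi> m) t)"
        by (subst sum.reindex[OF inj])
          (auto intro!: sum.cong simp: the_inv_into_f_f[OF inj], simp add: g_def)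
      then show ?thesis
        using zero[OF that] by simp
    qed
  qed
  then show ?thesis
    using assms(3) by (simp add: the_inv_into_f_f[OF inj])
qed

lemma eval_mpoly_orbit_1:
  assumes "t \<in> torus"
  shows "eval_mpoly p (torus_action w t 1) = (\<Sum>m\<in>Poly_Mapping.keys p.
    Poly_Mapping.lookup p m * torus_char (\<Sum>j\<in>UNIV. int (Poly_Mapping.lookup m j) *s w j) t)"
  using assms by (simp add: eval_mpoly_def torus_action_def torus_char_monomial)

text \<open>Distinct monomials in independent characters are distinct characters, hence linearly
  independent.\<close>

lemma algebraically_independent_on_orbit:
  fixes x :: "'k::alg_closed_field ^ 'n::finite" and w :: "'n \<Rightarrow> int ^ 'r::finite"
  assumes rel: "\<And>c. (\<Sum>i<d. c i *s w (\<beta> i)) = 0 \<Longrightarrow> \<forall>i<d. c i = 0"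
    and x: "\<And>i. i < d \<Longrightarrow> x $ \<beta> i = 1"
  shows "algebraically_independent_on (torus_orbit w x) (\<lambda>i. mvar (\<beta> i)) d"
  unfolding algebraically_independent_on_def
proof (intro allI impI ballI)
  fix S c and a :: "nat \<Rightarrow> nat"
  assume *: "finite S \<and> (\<forall>a\<in>S. \<forall>i\<ge>d. a i = (0::nat)) \<and>
      (\<forall>x\<in>torus_orbit w x. (\<Sum>a\<in>S. c a * (\<Prod>i<d. eval_mpoly (mvar (\<beta> i)) x ^ a i)) = 0)"
    and a: "a \<in> S"
  show "c a = 0"
  proof (rule torus_chars_linear_independent[where E = S and c = c and
        \<phi> = "\<lambda>a. \<Sum>i<d. int (a i) *s w (\<beta> i)"])
    show "inj_on (\<lambda>a. \<Sum>i<d. int (a i) *s w (\<beta> i)) S"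
    proof (rule inj_onI)
      fix a b assume ab: "a \<in> S" "b \<in> S"
        "(\<Sum>i<d. int (a i) *s w (\<beta> i)) = (\<Sum>i<d. int (b i) *s w (\<beta> i))"
      then have "(\<Sum>i<d. (int (a i) - int (b i)) *s w (\<beta> i)) = 0"
        by (simp add: vector_sub_rdistrib sum_subtractf)
      then have "a i = b i" if "i < d" for i
        using rel[of "\<lambda>i. int (a i) - int (b i)"] that by simp
      moreover have "a i = b i" if "i \<ge> d" for i
        using * ab(1,2) that by metis
      ultimately show "a = b"
        by (metis ext linorder_not_le)
    qed
    show "(\<Sum>a\<in>S. c a * torus_char (\<Sum>i<d. int (a i) *s w (\<beta> i)) t) = 0"
      if t: "t \<in> torus" for t :: "'k ^ 'r"
    proof -
      have "torus_action w t x \<in> torus_orbit w x"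
        using t by (simp add: torus_orbit_def)
      then have "(\<Sum>a\<in>S. c a * (\<Prod>i<d. eval_mpoly (mvar (\<beta> i)) (torus_action w t x) ^ a i)) = 0"
        using * by blast
      then show ?thesis
        using x by (simp add: torus_char_monomial[OF t] torus_action_def)
    qed
  qed (use * a in simp_all)
qed

text \<open>Gaussian elimination: an equation with a nonzero coefficient at \<open>b\<close>
  eliminates the unknown \<open>b\<close> from the others and determines it afterwards.\<close>

lemma underdetermined_system_nontrivial_solution:
  fixes M :: "'a \<Rightarrow> 'b \<Rightarrow> 'k::field"
  assumes "finite L" "finite A" "card L < card A"
  shows "\<exists>c. (\<exists>a\<in>A. c a \<noteq> 0) \<and> (\<forall>l\<in>L. (\<Sum>a\<in>A. c a * M a l) = 0)"
  using assms
proof (induction L arbitrary: A M rule: finite_induct)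
  case empty
  then have "A \<noteq> {}"
    by auto
  then show ?case
    by (intro exI[of _ "\<lambda>_. 1"]) auto
next
  case (insert l L)
  show ?case
  proof (cases "\<forall>a\<in>A. M a l = 0")
    case True
    obtain c where "\<exists>a\<in>A. c a \<noteq> 0" "\<forall>l\<in>L. (\<Sum>a\<in>A. c a * M a l) = 0"
      using insert.IH[of A M] insert.prems insert.hyps by auto
    then show ?thesis
      using True by (intro exI[of _ c]) simp
  next
    case False
    then obtain b where b: "b \<in> A" "M b l \<noteq> 0"
      by blast
    let ?A = "A - {b}"
    define f where "f a = M a l / M b l" for a
    have "card L < card ?A"
      using insert.prems insert.hyps b by simp
    then obtain c where c: "\<exists>a\<in>?A. c a \<noteq> 0"
        "\<forall>l'\<in>L. (\<Sum>a\<in>?A. c a * (M a l' - f a * M b l')) = 0"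
      using insert.IH[of ?A "\<lambda>a l'. M a l' - f a * M b l'"] insert.prems by auto
    define c' where "c' = c(b := - (\<Sum>a\<in>?A. c a * f a))"
    have sum: "(\<Sum>a\<in>A. c' a * M a l') = (\<Sum>a\<in>?A. c a * (M a l' - f a * M b l'))" for l'
    proof -
      have "(\<Sum>a\<in>A. c' a * M a l') = c' b * M b l' + (\<Sum>a\<in>?A. c' a * M a l')"
        using insert.prems(1) b(1) by (rule sum.remove)
      also have "(\<Sum>a\<in>?A. c' a * M a l') = (\<Sum>a\<in>?A. c a * M a l')"
        by (intro sum.cong) (auto simp: c'_def)
      finally show ?thesis
        by (simp add: c'_def sum_distrib_right right_diff_distrib sum_subtractf mult.assoc)
    qed
    have "(\<Sum>a\<in>A. c' a * M a l) = 0"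
      unfolding sum using b by (simp add: f_def)
    moreover have "\<exists>a\<in>A. c' a \<noteq> 0"
      using c(1) by (auto simp: c'_def)
    ultimately show ?thesis
      using c(2) sum by (intro exI[of _ c']) auto
  qed
qed

section \<open>Degree bounds and the counting argument on the orbit\<close>

definition exponent_degree :: "('n::finite \<Rightarrow>\<^sub>0 nat) \<Rightarrow> nat" where
  "exponent_degree m = (\<Sum>j\<in>UNIV. Poly_Mapping.lookup m j)"

definition mpoly_degree_le :: "('n::finite, 'k::field) mpoly \<Rightarrow> nat \<Rightarrow> bool" where
  "mpoly_degree_le p D \<longleftrightarrow> (\<forall>m\<in>Poly_Mapping.keys p. exponent_degree m \<le> D)"

lemma mpoly_degree_le_1: "mpoly_degree_le 1 D"
  by (simp add: mpoly_degree_le_def exponent_degree_def)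

lemma mpoly_degree_le_mult:
  assumes "mpoly_degree_le p D" "mpoly_degree_le q D'"
  shows "mpoly_degree_le (p * q) (D + D')"
  unfolding mpoly_degree_le_def
proof
  fix m assume "m \<in> Poly_Mapping.keys (p * q)"
  then obtain a b where "m = a + b" "a \<in> Poly_Mapping.keys p" "b \<in> Poly_Mapping.keys q"
    using keys_mult[of p q] by blast
  then show "exponent_degree m \<le> D + D'"
    using assms
    by (simp add: mpoly_degree_le_def exponent_degree_def lookup_add sum.distrib add_mono)
qed

lemma mpoly_degree_le_power:
  assumes "mpoly_degree_le p D"
  shows "mpoly_degree_le (p ^ k) (k * D)"
  by (induction k) (simp_all add: mpoly_degree_le_1 mpoly_degree_le_mult assms)

lemma mpoly_degree_le_prod:
  assumes "\<And>i. i \<in> A \<Longrightarrow> mpoly_degree_le (p i) (D i)"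
  shows "mpoly_degree_le (\<Prod>i\<in>A. p i) (\<Sum>i\<in>A. D i)"
  using assms
  by (induction A rule: infinite_finite_induct) (simp_all add: mpoly_degree_le_1 mpoly_degree_le_mult)

lemma mpoly_degree_le_exists: "\<exists>D. mpoly_degree_le p D"
  unfolding mpoly_degree_le_def
  by (rule exI[of _ "Max (insert 0 (exponent_degree ` Poly_Mapping.keys p))"]) simp

lemma mpoly_degree_le_trans: "mpoly_degree_le p D \<Longrightarrow> D \<le> D' \<Longrightarrow> mpoly_degree_le p D'"
  by (force simp: mpoly_degree_le_def)

lemma card_image_le_of_determined:
  assumes "finite (u ` E)" "\<And>x y. x \<in> E \<Longrightarrow> y \<in> E \<Longrightarrow> u x = u y \<Longrightarrow> f x = f y"
  shows "card (f ` E) \<le> card (u ` E)"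
proof (rule surj_card_le[OF assms(1)])
  show "f ` E \<subseteq> (\<lambda>z. f (inv_into E u z)) ` (u ` E)"
  proof
    fix y assume "y \<in> f ` E"
    then obtain x where x: "x \<in> E" "y = f x"
      by blast
    then have "y = f (inv_into E u (u x))"
      using assms(2)[of x "inv_into E u (u x)"] by (simp add: inv_into_into f_inv_into_f)
    then show "y \<in> (\<lambda>z. f (inv_into E u z)) ` (u ` E)"
      using x by blast
  qed
qed

text \<open>The characters of monomials of degree at most \<open>K\<close> lie in a lattice of rank
  \<open>card B\<close>, in a box of side length linear in \<open>K\<close>.\<close>

lemma card_monomial_weights_le:
  fixes w :: "'n::finite \<Rightarrow> int ^ 'r::finite" and B :: "'n set"
  assumes M: "M \<noteq> 0" "\<And>j. M *s w j = (\<Sum>b\<in>B. C j b *s w b)"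
    and C: "\<And>j b. \<bar>C j b\<bar> \<le> int c"
    and E: "\<And>m. m \<in> E \<Longrightarrow> exponent_degree m \<le> K"
  shows "card ((\<lambda>m. \<Sum>j\<in>UNIV. int (Poly_Mapping.lookup m j) *s w j) ` E)
    \<le> (2 * c * K + 1) ^ card B"
proof -
  let ?\<phi> = "\<lambda>m. \<Sum>j\<in>UNIV. int (Poly_Mapping.lookup m j) *s w j"
  \<comment> \<open>These are coordinates of \<open>M\<close> times the weight of the monomial
    \<open>m\<close>; the weight itself may have no integral coordinates with respect to
    \<open>B\<close>.\<close>
  define u where "u m b = (\<Sum>j\<in>UNIV. int (Poly_Mapping.lookup m j) * C j b)"
    for m :: "'n \<Rightarrow>\<^sub>0 nat" and b
  let ?u = "\<lambda>m. restrict (u m) B"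
  have M\<phi>: "M *s ?\<phi> m = (\<Sum>b\<in>B. u m b *s w b)" for m
  proof -
    have "M *s ?\<phi> m = (\<Sum>j\<in>UNIV. int (Poly_Mapping.lookup m j) *s (M *s w j))"
      by (simp add: vec_eq_iff sum_distrib_left mult_ac)
    also have "\<dots> = (\<Sum>j\<in>UNIV. \<Sum>b\<in>B. (int (Poly_Mapping.lookup m j) * C j b) *s w b)"
      unfolding M(2) by (simp add: vec_eq_iff sum_distrib_left mult_ac)
    also have "\<dots> = (\<Sum>b\<in>B. \<Sum>j\<in>UNIV. (int (Poly_Mapping.lookup m j) * C j b) *s w b)"
      by (rule sum.swap)
    finally show ?thesis
      by (simp add: u_def vec_eq_iff sum_distrib_right)
  qed
  let ?I = "{- int (c * K)..int (c * K)}"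
  have sub: "?u ` E \<subseteq> B \<rightarrow>\<^sub>E ?I"
  proof
    fix v assume "v \<in> ?u ` E"
    then obtain m where m: "m \<in> E" "v = ?u m"
      by blast
    have "\<bar>u m b\<bar> \<le> int (c * K)" for b
    proof -
      have "\<bar>u m b\<bar> \<le> (\<Sum>j\<in>UNIV. \<bar>int (Poly_Mapping.lookup m j) * C j b\<bar>)"
        unfolding u_def by (rule sum_abs)
      also have "\<dots> \<le> (\<Sum>j\<in>UNIV. int (Poly_Mapping.lookup m j) * int c)"
        using C by (intro sum_mono) (simp add: abs_mult mult_left_mono)
      also have "\<dots> = int (exponent_degree m) * int c"
        by (simp add: exponent_degree_def sum_distrib_right)
      also have "\<dots> \<le> int K * int c"
        using E[OF m(1)] by (intro mult_right_mono) simp_all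
      finally show ?thesis
        by (simp add: mult.commute)
    qed
    then have "u m b \<in> ?I" for b
      by (simp add: abs_le_iff minus_le_iff)
    then show "v \<in> B \<rightarrow>\<^sub>E ?I"
      using m(2) by (simp add: restrict_PiE_iff)
  qed
  have fin: "finite (B \<rightarrow>\<^sub>E ?I)"
    by (intro finite_PiE) simp_all
  have "card (?\<phi> ` E) \<le> card (?u ` E)"
  proof (rule card_image_le_of_determined)
    show "finite (?u ` E)"
      using sub fin by (rule finite_subset)
    show "?\<phi> x = ?\<phi> y" if "?u x = ?u y" for x y
    proof -
      have "u x b = u y b" if "b \<in> B" for b
        using \<open>?u x = ?u y\<close> that by (metis restrict_apply')
      then have "M *s ?\<phi> x = M *s ?\<phi> y"
        unfolding M\<phi> by simp
      then show ?thesis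
        using M(1) by (simp add: vec_eq_iff)
    qed
  qed
  also have "\<dots> \<le> card (B \<rightarrow>\<^sub>E ?I)"
    using fin sub by (rule card_mono)
  also have "\<dots> = (2 * c * K + 1) ^ card B"
    by (simp add: card_funcsetE nat_add_distrib nat_mult_distrib mult_ac)
  finally show ?thesis .
qed

text \<open>There are \<open>N ^ d\<close> products of the \<open>P i\<close> with exponents below
  \<open>N\<close>, but the number of characters in them grows only like \<open>N ^ card B\<close>.
  If \<open>d\<close> exceeded \<open>card B\<close>, a nontrivial combination of the products would
  have coefficient 0 at every character.\<close>

lemma algebraically_independent_on_orbit_le:
  fixes w :: "'n::finite \<Rightarrow> int ^ 'r::finite" and P :: "nat \<Rightarrow> ('n, 'k::field) mpoly"
  assumes indep: "algebraically_independent_on (torus_orbit w 1) P d"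
    and M: "M \<noteq> 0" "\<And>j. M *s w j = (\<Sum>b\<in>B. C j b *s w b)"
  shows "d \<le> card B"
proof (rule ccontr)
  assume "\<not> d \<le> card B"
  then have d: "card B < d"
    by simp
  have "\<forall>i. \<exists>D. mpoly_degree_le (P i) D"
    by (intro allI mpoly_degree_le_exists)
  from choice[OF this] obtain D0 where D0: "\<forall>i. mpoly_degree_le (P i) (D0 i)"
    by blast
  define D where "D = (\<Sum>i<d. D0 i)"
  have D: "mpoly_degree_le (P i) D" if "i < d" for i
  proof -
    have "D0 i \<le> D"
      using member_le_sum[of i "{..<d}" D0] that by (simp add: D_def)
    moreover have "mpoly_degree_le (P i) (D0 i)"
      using D0 by blast
    ultimately show ?thesis
      by (rule mpoly_degree_le_trans[rotated])
  qed
  define c where "c = nat (\<Sum>j\<in>UNIV. \<Sum>b\<in>UNIV. \<bar>C j b\<bar>)"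
  have c: "\<bar>C j b\<bar> \<le> int c" for j b
  proof -
    have "\<bar>C j b\<bar> \<le> (\<Sum>b\<in>UNIV. \<bar>C j b\<bar>)"
      by (rule member_le_sum) simp_all
    also have "\<dots> \<le> (\<Sum>j\<in>UNIV. \<Sum>b\<in>UNIV. \<bar>C j b\<bar>)"
      by (rule member_le_sum) (simp_all add: sum_nonneg)
    finally show ?thesis
      by (simp add: c_def sum_nonneg)
  qed
  \<comment> \<open>The characters number at most \<open>(2 * c * (d * D * N) + 1) ^ card B\<close>,
    which is at most \<open>(R * N) ^ card B\<close>. The choice of \<open>N\<close> makes this
    smaller than \<open>N ^ Suc (card B)\<close>, hence smaller than \<open>N ^ d\<close>.\<close>
  define R where "R = 2 * c * (d * D) + 1"
  define N where "N = R ^ card B + 1"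
  have N: "N \<ge> 1" "R ^ card B < N"
    by (simp_all add: N_def)
  define A where "A = (\<lambda>f i. if i < d then f i else 0) ` ({..<d} \<rightarrow>\<^sub>E {..<N})"
  have A: "\<exists>f\<in>{..<d} \<rightarrow>\<^sub>E {..<N}. \<forall>i. a i = (if i < d then f i else 0)" if "a \<in> A" for a
    using that[unfolded A_def]
  proof (rule imageE)
    fix f assume "a = (\<lambda>i. if i < d then f i else 0)" "f \<in> {..<d} \<rightarrow>\<^sub>E {..<N}"
    then show ?thesis
      by (intro bexI[of _ f] allI) simp_all
  qed
  have A0: "a i = 0" if "a \<in> A" "i \<ge> d" for a i
    using A[OF that(1)] that(2) by auto
  have AN: "a i \<le> N" if a: "a \<in> A" "i < d" for a i
  proof -
    obtain f where f: "f \<in> {..<d} \<rightarrow>\<^sub>E {..<N}" "\<forall>i. a i = (if i < d then f i else 0)"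
      using A[OF a(1)] by blast
    have "f i < N"
      using PiE_mem[OF f(1), of i] a(2) by simp
    then show ?thesis
      using f(2) a(2) by simp
  qed
  have finA: "finite A"
    unfolding A_def by (intro finite_imageI finite_PiE) simp_all
  have "inj_on (\<lambda>f i. if i < d then f i else 0) ({..<d} \<rightarrow>\<^sub>E {..<N})"
  proof (rule inj_onI)
    fix f g assume fg: "f \<in> {..<d} \<rightarrow>\<^sub>E {..<N}" "g \<in> {..<d} \<rightarrow>\<^sub>E {..<N}"
      and eq: "(\<lambda>i. if i < d then f i else 0) = (\<lambda>i. if i < d then g i else 0)"
    show "f = g"
    proof (rule PiE_ext[OF fg])
      fix i assume "i \<in> {..<d}"
      then show "f i = g i"
        using fun_cong[OF eq, of i] by simp
    qed
  qed
  then have cardA: "card A = N ^ d"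
    by (simp add: A_def card_image card_funcsetE)
  define q where "q a = (\<Prod>i<d. P i ^ a i)" for a
  define E where "E = (\<Union>a\<in>A. Poly_Mapping.keys (q a))"
  have finE: "finite E"
    using finA by (simp add: E_def)
  define \<phi> where "\<phi> m = (\<Sum>j\<in>UNIV. int (Poly_Mapping.lookup m j) *s w j)"
    for m :: "'n \<Rightarrow>\<^sub>0 nat"
  have E: "exponent_degree m \<le> d * D * N" if m: "m \<in> E" for m
  proof -
    obtain a where a: "a \<in> A" "m \<in> Poly_Mapping.keys (q a)"
      using m by (auto simp: E_def)
    have "mpoly_degree_le (q a) (\<Sum>i<d. a i * D)"
      unfolding q_def by (intro mpoly_degree_le_prod mpoly_degree_le_power D) simp
    then have "exponent_degree m \<le> (\<Sum>i<d. a i * D)"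
      using a(2) by (simp add: mpoly_degree_le_def)
    also have "\<dots> \<le> (\<Sum>i<d. N * D)"
      using AN[OF a(1)] by (intro sum_mono mult_right_mono) simp_all
    finally show ?thesis
      by (simp add: mult_ac)
  qed
  have "card (\<phi> ` E) \<le> (2 * c * (d * D * N) + 1) ^ card B"
    unfolding \<phi>_def using M c E by (rule card_monomial_weights_le)
  also have "\<dots> \<le> (R * N) ^ card B"
    using N(1) by (intro power_mono) (simp_all add: R_def distrib_right)
  also have "\<dots> = R ^ card B * N ^ card B"
    by (rule power_mult_distrib)
  also have "\<dots> < N * N ^ card B"
    using N by (intro mult_strict_right_mono) simp_all
  also have "\<dots> = N ^ Suc (card B)"
    by simp
  also have "\<dots> \<le> N ^ d"
    using d N(1) by (intro power_increasing) simp_all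
  finally have "card (\<phi> ` E) < card A"
    by (simp add: cardA)
  \<comment> \<open>One equation for each character \<open>l\<close>: the total coefficient of
    \<open>l\<close> in the combination of the products \<open>q a\<close> vanishes.\<close>
  then have "\<exists>e. (\<exists>a\<in>A. e a \<noteq> 0) \<and> (\<forall>l\<in>\<phi> ` E. (\<Sum>a\<in>A. e a *
      (\<Sum>m | m \<in> E \<and> \<phi> m = l. Poly_Mapping.lookup (q a) m)) = 0)"
    using finE finA by (intro underdetermined_system_nontrivial_solution) simp_all
  then obtain e where e: "\<exists>a\<in>A. e a \<noteq> 0" "\<forall>l\<in>\<phi> ` E. (\<Sum>a\<in>A. e a *
      (\<Sum>m | m \<in> E \<and> \<phi> m = l. Poly_Mapping.lookup (q a) m)) = 0"
    by blast
  have rel: "(\<Sum>a\<in>A. e a * (\<Prod>i<d. eval_mpoly (P i) x ^ a i)) = 0" if x: "x \<in> torus_orbit w 1" for x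
  proof -
    obtain t where t: "t \<in> torus" "x = torus_action w t 1"
      using x by (auto simp: torus_orbit_def)
    have q_eval: "eval_mpoly (q a) x = (\<Sum>l\<in>\<phi> ` E.
        (\<Sum>m | m \<in> E \<and> \<phi> m = l. Poly_Mapping.lookup (q a) m) * torus_char l t)" if "a \<in> A" for a
    proof -
      have "eval_mpoly (q a) x = (\<Sum>m\<in>Poly_Mapping.keys (q a).
          Poly_Mapping.lookup (q a) m * torus_char (\<phi> m) t)"
        by (simp add: t(2) eval_mpoly_orbit_1[OF t(1)] \<phi>_def)
      also have "\<dots> = (\<Sum>m\<in>E. Poly_Mapping.lookup (q a) m * torus_char (\<phi> m) t)"
        using finE that by (intro sum.mono_neutral_left) (auto simp: E_def in_keys_iff)
      also have "\<dots> = (\<Sum>l\<in>\<phi> ` E. \<Sum>m | m \<in> E \<and> \<phi> m = l.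
          Poly_Mapping.lookup (q a) m * torus_char (\<phi> m) t)"
        by (rule sum.image_gen[OF finE])
      finally show ?thesis
        by (simp add: sum_distrib_right)
    qed
    have "(\<Sum>a\<in>A. e a * (\<Prod>i<d. eval_mpoly (P i) x ^ a i)) = (\<Sum>a\<in>A. e a * eval_mpoly (q a) x)"
      by (simp add: q_def eval_mpoly_prod eval_mpoly_power)
    also have "\<dots> = (\<Sum>a\<in>A. \<Sum>l\<in>\<phi> ` E. e a *
        ((\<Sum>m | m \<in> E \<and> \<phi> m = l. Poly_Mapping.lookup (q a) m) * torus_char l t))"
      by (intro sum.cong refl) (simp add: q_eval sum_distrib_left)
    also have "\<dots> = (\<Sum>l\<in>\<phi> ` E. \<Sum>a\<in>A. e a *
        ((\<Sum>m | m \<in> E \<and> \<phi> m = l. Poly_Mapping.lookup (q a) m) * torus_char l t))"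
      by (rule sum.swap)
    also have "\<dots> = (\<Sum>l\<in>\<phi> ` E. (\<Sum>a\<in>A. e a *
        (\<Sum>m | m \<in> E \<and> \<phi> m = l. Poly_Mapping.lookup (q a) m)) * torus_char l t)"
      by (simp add: sum_distrib_right mult.assoc)
    also have "\<dots> = 0"
      by (intro sum.neutral ballI) (simp only: e(2)[rule_format] mult_zero_left)
    finally show ?thesis .
  qed
  have "e a = 0" if "a \<in> A" for a
    by (rule algebraically_independent_onD[OF indep, where S = A and c = e])
      (use finA A0 rel that in simp_all)
  then show False
    using e(1) by blast
qed

section \<open>Rational weights and facets\<close>

lemma span_image_eq_sum:
  fixes f :: "'a \<Rightarrow> 'k::field ^ 'm::finite"
  assumes "finite B" "x \<in> vec.span (f ` B)"
  shows "\<exists>c. x = (\<Sum>b\<in>B. c b *s f b)"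
proof -
  let ?V = "{x. \<exists>c. x = (\<Sum>b\<in>B. c b *s f b)}"
  have "vec.subspace ?V"
  proof (rule vec.subspaceI)
    show "0 \<in> ?V"
      by (auto intro!: exI[of _ "\<lambda>_. 0"])
    show "x + y \<in> ?V" if xy: "x \<in> ?V" "y \<in> ?V" for x y
    proof -
      obtain c c' where "x = (\<Sum>b\<in>B. c b *s f b)" "y = (\<Sum>b\<in>B. c' b *s f b)"
        using xy by blast
      then have "x + y = (\<Sum>b\<in>B. (c b + c' b) *s f b)"
        by (simp add: vector_sadd_rdistrib sum.distrib)
      then show ?thesis
        by (intro CollectI exI[of _ "\<lambda>b. c b + c' b"])
    qed
    show "a *s x \<in> ?V" if x: "x \<in> ?V" for a x
    proof -
      obtain c where "x = (\<Sum>b\<in>B. c b *s f b)"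
        using x by blast
      then have "a *s x = (\<Sum>b\<in>B. (a * c b) *s f b)"
        by (simp add: vec.scale_sum_right)
      then show ?thesis
        by (intro CollectI exI[of _ "\<lambda>b. a * c b"])
    qed
  qed
  moreover have "f ` B \<subseteq> ?V"
  proof
    fix y assume "y \<in> f ` B"
    then obtain b where b: "b \<in> B" "y = f b"
      by blast
    have "y = (\<Sum>b'\<in>B. if b' = b then f b else 0)"
      using b assms(1) by simp
    also have "\<dots> = (\<Sum>b'\<in>B. (if b' = b then 1 else 0) *s f b')"
      by (intro sum.cong) auto
    finally show "y \<in> ?V"
      by (intro CollectI exI[of _ "\<lambda>b'. if b' = b then 1 else 0"])
  qed
  ultimately have "vec.span (f ` B) \<subseteq> ?V"
    by (intro vec.span_minimal)
  then show ?thesis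
    using assms(2) by blast
qed

text \<open>The formulation by relations counts a repeated vector as a dependence, through the
  relation with coefficients 1 and -1; injectivity expresses the same on the side of sets.\<close>

lemma independent_family_iff:
  fixes v :: "'a \<Rightarrow> 'k::field ^ 'm::finite"
  assumes "finite B"
  shows "inj_on v B \<and> vec.independent (v ` B) \<longleftrightarrow>
    (\<forall>c. (\<Sum>j\<in>B. c j *s v j) = 0 \<longrightarrow> (\<forall>j\<in>B. c j = 0))"
proof
  assume v: "inj_on v B \<and> vec.independent (v ` B)"
  show "\<forall>c. (\<Sum>j\<in>B. c j *s v j) = 0 \<longrightarrow> (\<forall>j\<in>B. c j = 0)"
  proof (intro allI impI ballI)
    fix c j assume c: "(\<Sum>j\<in>B. c j *s v j) = 0" and j: "j \<in> B"
    have inj: "inj_on v B"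
      using v by simp
    have "(\<Sum>x\<in>v ` B. c (the_inv_into B v x) *s x) = (\<Sum>j\<in>B. c j *s v j)"
      by (subst sum.reindex[OF inj]) (auto intro!: sum.cong simp: the_inv_into_f_f[OF inj])
    then have "c (the_inv_into B v (v j)) = 0"
      using vec.independentD[of "v ` B" "v ` B" "\<lambda>x. c (the_inv_into B v x)" "v j"] v c j assms
      by simp
    then show "c j = 0"
      using j by (simp add: the_inv_into_f_f[OF inj])
  qed
next
  assume c: "\<forall>c. (\<Sum>j\<in>B. c j *s v j) = 0 \<longrightarrow> (\<forall>j\<in>B. c j = 0)"
  have inj: "inj_on v B"
  proof (rule inj_onI, rule ccontr)
    fix i j assume ij: "i \<in> B" "j \<in> B" "v i = v j" "i \<noteq> j"
    let ?c = "\<lambda>l. (if l = i then 1 else 0) - (if l = j then 1 else 0) :: 'k"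
    have "(\<Sum>l\<in>B. ?c l *s v l) =
        (\<Sum>l\<in>B. if l = i then v i else 0) - (\<Sum>l\<in>B. if l = j then v j else 0)"
      unfolding sum_subtractf[symmetric] by (intro sum.cong) auto
    then have "(\<Sum>l\<in>B. ?c l *s v l) = 0"
      using ij assms by simp
    then have "?c i = 0"
      using c[THEN spec[of _ ?c]] ij(1) by blast
    then show False
      using ij(4) by simp
  qed
  moreover have "vec.independent (v ` B)"
  proof
    assume "vec.dependent (v ` B)"
    then obtain u where u: "\<exists>x\<in>v ` B. u x \<noteq> 0" "(\<Sum>x\<in>v ` B. u x *s x) = 0"
      using assms by (auto simp: vec.dependent_finite)
    have "(\<Sum>j\<in>B. u (v j) *s v j) = 0"
      using u(2) by (subst (asm) sum.reindex[OF inj]) simp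
    then have "\<forall>j\<in>B. u (v j) = 0"
      using c[THEN spec[of _ "\<lambda>j. u (v j)"]] by blast
    then show False
      using u(1) by blast
  qed
  ultimately show "inj_on v B \<and> vec.independent (v ` B)"
    by simp
qed

lemma rat_weight_eq_0_iff: "rat_weight a = 0 \<longleftrightarrow> a = 0"
  by (simp add: rat_weight_def vec_eq_iff)

lemma rat_weight_eq_iff: "rat_weight a = rat_weight b \<longleftrightarrow> a = b"
  by (simp add: rat_weight_def vec_eq_iff)

lemma rat_weight_scale: "rat_weight (c *s a) = of_int c *s rat_weight a"
  by (simp add: rat_weight_def vec_eq_iff)

lemma rat_weight_sum: "rat_weight (\<Sum>j\<in>A. f j) = (\<Sum>j\<in>A. rat_weight (f j))"
  by (simp add: rat_weight_def vec_eq_iff)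

lemma common_denominator:
  assumes "finite A"
  shows "\<exists>M k. M > 0 \<and> (\<forall>j\<in>A. of_int M * (r j :: rat) = of_int (k j))"
proof -
  define M where "M = (\<Prod>j\<in>A. snd (quotient_of (r j)))"
  have "M > 0"
    unfolding M_def by (intro prod_pos) (simp add: quotient_of_denom_pos')
  moreover have "\<exists>k. of_int M * r j = of_int k" if j: "j \<in> A" for j
  proof -
    obtain a b where ab: "quotient_of (r j) = (a, b)"
      by force
    have "b dvd M"
      unfolding M_def using dvd_prodI[OF assms j, of "\<lambda>j. snd (quotient_of (r j))"] ab by simp
    then obtain e where "M = b * e"
      by blast
    moreover have "r j = of_int a / of_int b" "b > 0"
      using ab by (simp_all add: quotient_of_div quotient_of_denom_pos)
    ultimately have "of_int M * r j = of_int (a * e)"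
      by simp
    then show ?thesis
      by blast
  qed
  ultimately show ?thesis
    by metis
qed

lemma rational_relations_trivial_iff:
  assumes "finite B"
  shows "(\<forall>c. (\<Sum>j\<in>B. c j *s rat_weight (w j)) = 0 \<longrightarrow> (\<forall>j\<in>B. c j = 0)) \<longleftrightarrow>
    (\<forall>c. (\<Sum>j\<in>B. c j *s w j) = 0 \<longrightarrow> (\<forall>j\<in>B. c j = 0))"
proof
  assume *: "\<forall>c. (\<Sum>j\<in>B. c j *s rat_weight (w j)) = 0 \<longrightarrow> (\<forall>j\<in>B. c j = 0)"
  show "\<forall>c. (\<Sum>j\<in>B. c j *s w j) = 0 \<longrightarrow> (\<forall>j\<in>B. c j = 0)"
  proof (intro allI impI)
    fix c assume "(\<Sum>j\<in>B. c j *s w j) = 0"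
    then have "rat_weight (\<Sum>j\<in>B. c j *s w j) = 0"
      by (simp add: rat_weight_eq_0_iff)
    then have "(\<Sum>j\<in>B. of_int (c j) *s rat_weight (w j)) = 0"
      by (simp add: rat_weight_sum rat_weight_scale)
    then show "\<forall>j\<in>B. c j = 0"
      using *[THEN spec[of _ "\<lambda>j. of_int (c j)"]] by simp
  qed
next
  assume *: "\<forall>c. (\<Sum>j\<in>B. c j *s w j) = 0 \<longrightarrow> (\<forall>j\<in>B. c j = 0)"
  show "\<forall>c. (\<Sum>j\<in>B. c j *s rat_weight (w j)) = 0 \<longrightarrow> (\<forall>j\<in>B. c j = 0)"
  proof (intro allI impI)
    fix c assume c: "(\<Sum>j\<in>B. c j *s rat_weight (w j)) = 0"
    obtain M k where k: "M > 0" "\<And>j. j \<in> B \<Longrightarrow> of_int M * c j = of_int (k j)"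
      using common_denominator[OF assms, of c] by blast
    have "rat_weight (\<Sum>j\<in>B. k j *s w j) = (\<Sum>j\<in>B. (of_int M * c j) *s rat_weight (w j))"
      using k(2) by (simp add: rat_weight_sum rat_weight_scale)
    also have "\<dots> = of_int M *s (\<Sum>j\<in>B. c j *s rat_weight (w j))"
      by (simp add: vec.scale_sum_right)
    finally have "(\<Sum>j\<in>B. k j *s w j) = 0"
      by (simp add: c rat_weight_eq_0_iff)
    then have "k j = 0" if "j \<in> B" for j
      using * that by blast
    then show "\<forall>j\<in>B. c j = 0"
      using k by fastforce
  qed
qed

lemma independent_weights_iff:
  "independent_weights w \<longleftrightarrow> (\<forall>c. (\<Sum>j\<in>UNIV. c j *s w j) = 0 \<longrightarrow> (\<forall>j. c j = 0))"
  for w :: "'n::finite \<Rightarrow> int ^ 'r::finite"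
  using independent_family_iff[of UNIV "\<lambda>j. rat_weight (w j)"]
    rational_relations_trivial_iff[of UNIV w]
  by (simp add: independent_weights_def)

text \<open>One common denominator over all pairs \<open>(j, b)\<close> yields a single
  \<open>M\<close>, the form in which the counting argument uses the rank.\<close>

lemma integer_span_coefficients:
  fixes w :: "'n::finite \<Rightarrow> int ^ 'r::finite"
  assumes "\<And>j. rat_weight (w j) \<in> vec.span ((\<lambda>j. rat_weight (w j)) ` B)"
  shows "\<exists>M C. M \<noteq> 0 \<and> (\<forall>j. M *s w j = (\<Sum>b\<in>B. C j b *s w b))"
proof -
  have "\<forall>j. \<exists>c. rat_weight (w j) = (\<Sum>b\<in>B. c b *s rat_weight (w b))"
    using span_image_eq_sum[OF _ assms] by simp
  then obtain c where c: "\<And>j. rat_weight (w j) = (\<Sum>b\<in>B. c j b *s rat_weight (w b))"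
    by (auto dest!: choice)
  obtain M k where k: "M > 0" "\<And>j b. of_int M * c j b = of_int (k (j, b))"
    using common_denominator[of UNIV "\<lambda>(j, b). c j b"] by auto
  have "rat_weight (M *s w j) = rat_weight (\<Sum>b\<in>B. k (j, b) *s w b)" for j
  proof -
    have "rat_weight (M *s w j) = of_int M *s (\<Sum>b\<in>B. c j b *s rat_weight (w b))"
      unfolding rat_weight_scale by (simp flip: c)
    also have "\<dots> = (\<Sum>b\<in>B. (of_int M * c j b) *s rat_weight (w b))"
      by (simp add: vec.scale_sum_right)
    also have "\<dots> = rat_weight (\<Sum>b\<in>B. k (j, b) *s w b)"
      by (simp add: k(2) rat_weight_sum rat_weight_scale)
    finally show ?thesis .
  qed
  then have "M *s w j = (\<Sum>b\<in>B. k (j, b) *s w b)" for j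
    by (simp add: rat_weight_eq_iff)
  then show ?thesis
    using k(1) by (intro exI[of _ M] exI[of _ "\<lambda>j b. k (j, b)"]) simp
qed

section \<open>Functionals on the weights and facets of their cone\<close>

lemma scalar_product_add_scale:
  "scalar_product (u + t *s u') y = scalar_product u y + t * scalar_product u' y"
  for u :: "'a::comm_ring_1 ^ 'm::finite"
  by (simp add: scalar_product_def distrib_right sum.distrib sum_distrib_left mult.assoc)

lemma scalar_product_uminus: "scalar_product (- u) y = - scalar_product u y"
  for u :: "'a::comm_ring_1 ^ 'm::finite"
  by (simp add: scalar_product_def sum_negf)

text \<open>Among the functionals that are nonnegative on the family and positive at \<open>p\<close>, take one
  with the most zeros. If its zeros together with \<open>v p\<close> did not span, it could be tilted along
  a functional vanishing on them until it acquires a new zero.\<close>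

lemma facet_not_containing:
  fixes v :: "'n::finite \<Rightarrow> 'a::linordered_field ^ 'm::finite"
  assumes h: "\<And>j. scalar_product h (v j) > 0"
  shows "\<exists>u. (\<forall>j. scalar_product u (v j) \<ge> 0) \<and> scalar_product u (v p) > 0 \<and>
    (\<forall>j. v j \<in> vec.span (v ` insert p {j. scalar_product u (v j) = 0}))"
proof -
  let ?good = "\<lambda>u. (\<forall>j. scalar_product u (v j) \<ge> 0) \<and> scalar_product u (v p) > 0"
  let ?Z = "\<lambda>u. {j. scalar_product u (v j) = 0}"
  have "?good h"
    using h by (auto intro: less_imp_le)
  moreover have "\<forall>u. ?good u \<longrightarrow> card (?Z u) < Suc (CARD('n))"
    by (simp add: card_mono less_Suc_eq_le)
  ultimately obtain u where u: "?good u" and max: "\<And>u'. ?good u' \<Longrightarrow> card (?Z u') \<le> card (?Z u)"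
    using ex_has_greatest_nat[of ?good h "\<lambda>u. card (?Z u)" "Suc (CARD('n))"] by blast
  have "v j \<in> vec.span (v ` insert p (?Z u))" for j
  proof (rule ccontr)
    assume "v j \<notin> vec.span (v ` insert p (?Z u))"
    then obtain m where m: "\<forall>y\<in>v ` insert p (?Z u). scalar_product m y = 0"
        "scalar_product m (v j) \<noteq> 0"
      using linear_separates_point by blast
    \<comment> \<open>The sign makes \<open>n\<close> negative at \<open>v j\<close>, so that adding
      large multiples of \<open>n\<close> eventually violates nonnegativity.\<close>
    define n where "n = (if scalar_product m (v j) < 0 then m else - m)"
    have n: "\<And>i. i \<in> insert p (?Z u) \<Longrightarrow> scalar_product n (v i) = 0" "scalar_product n (v j) < 0"
      using m by (auto simp: n_def scalar_product_uminus)
    define N where "N = {i. scalar_product n (v i) < 0}"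
    define f where "f i = scalar_product u (v i) / - scalar_product n (v i)" for i
    \<comment> \<open>The largest tilt that keeps all values nonnegative. An index \<open>l\<close>
      attaining the minimum becomes a new zero; the old zeros and the value at \<open>p\<close> are
      unchanged because \<open>n\<close> vanishes there.\<close>
    define t where "t = Min (f ` N)"
    have N: "finite N" "N \<noteq> {}"
      using n(2) by (auto simp: N_def)
    then have "t \<in> f ` N"
      unfolding t_def by (intro Min_in) simp_all
    then obtain l where l: "l \<in> N" "t = f l"
      by blast
    have t_le: "t \<le> f i" if "i \<in> N" for i
      using N that by (simp add: t_def)
    have t0: "t \<ge> 0"
      unfolding l(2) f_def using l(1) u by (intro divide_nonneg_nonneg) (auto simp: N_def)
    let ?u = "u + t *s n"
    have "scalar_product ?u (v i) \<ge> 0" for i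
    proof (cases "i \<in> N")
      case True
      then have "t * - scalar_product n (v i) \<le> scalar_product u (v i)"
        using t_le[OF True] by (simp add: f_def N_def field_simps)
      then show ?thesis
        by (simp add: scalar_product_add_scale)
    next
      case False
      then show ?thesis
        using u t0 by (simp add: scalar_product_add_scale N_def)
    qed
    moreover have "scalar_product ?u (v p) > 0"
      using u n(1)[of p] by (simp add: scalar_product_add_scale)
    ultimately have "card (?Z ?u) \<le> card (?Z u)"
      by (intro max) simp
    moreover have "l \<notin> ?Z u"
      using l(1) n(1)[of l] by (auto simp: N_def)
    moreover have "insert l (?Z u) \<subseteq> ?Z ?u"
    proof -
      have "scalar_product ?u (v l) = 0"
        unfolding scalar_product_add_scale l(2) f_def using l(1) by (simp add: N_def)
      then show ?thesis
        using n(1) by (auto simp: scalar_product_add_scale)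
    qed
    then have "card (insert l (?Z u)) \<le> card (?Z ?u)"
      by (intro card_mono) simp_all
    ultimately show False
      by simp
  qed
  then show ?thesis
    using u by (intro exI[of _ u]) simp
qed

text \<open>Relations are the vectors orthogonal to the rows of the matrix with columns
  \<open>v j\<close>. By hypothesis the all-ones vector is orthogonal to every relation, so it lies
  in the row space, and its coefficients there form \<open>h\<close>.\<close>

lemma affine_functional_exists:
  fixes v :: "'n::finite \<Rightarrow> 'a::field ^ 'm::finite"
  assumes rel: "\<And>c. (\<Sum>j\<in>UNIV. c j *s v j) = 0 \<Longrightarrow> (\<Sum>j\<in>UNIV. c j) = 0"
  obtains h where "\<And>j. scalar_product h (v j) = 1"
proof -
  define row :: "'m \<Rightarrow> 'a ^ 'n" where "row i = (\<chi> j. v j $ i)" for i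
  have "1 \<in> vec.span (range row)"
  proof (rule ccontr)
    assume "1 \<notin> vec.span (range row)"
    then obtain u where u: "\<forall>y\<in>range row. scalar_product u y = 0" "scalar_product u 1 \<noteq> 0"
      using linear_separates_point by blast
    have "(\<Sum>j\<in>UNIV. u $ j *s v j) = 0"
      using u(1) by (simp add: vec_eq_iff scalar_product_def row_def)
    then have "(\<Sum>j\<in>UNIV. u $ j) = 0"
      by (rule rel)
    then show False
      using u(2) by (simp add: scalar_product_def)
  qed
  then obtain c where c: "1 = (\<Sum>i\<in>UNIV. c i *s row i)"
    using span_image_eq_sum[of UNIV 1 row] by auto
  have "scalar_product (\<chi> i. c i) (v j) = 1" for j
  proof -
    have "1 = (\<Sum>i\<in>UNIV. c i *s row i) $ j"
      by (simp flip: c)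
    then show ?thesis
      by (simp add: scalar_product_def row_def)
  qed
  then show thesis
    by (rule that)
qed

text \<open>A one-parameter subgroup needs integer exponents; the positive factor \<open>M\<close>
  preserves signs and zeros of the functional.\<close>

lemma integral_functional:
  fixes u :: "rat ^ 'r::finite"
  obtains M h where "M > 0" "\<And>a. rat_of_int (scalar_product h a) = of_int M * scalar_product u (rat_weight a)"
proof -
  obtain M k where k: "M > 0" "\<And>i. of_int M * u $ i = of_int (k i)"
    using common_denominator[of UNIV "\<lambda>i. u $ i"] by auto
  have "rat_of_int (scalar_product (\<chi> i. k i) a) = of_int M * scalar_product u (rat_weight a)" for a
    by (simp add: scalar_product_def rat_weight_def sum_distrib_left flip: k(2) mult.assoc)
  then show thesis
    using that[OF k(1)] by blast
qed

section \<open>Orbit closures and the strong separation property\<close>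

text \<open>A relation between the functions is itself a polynomial equation, so it extends from
  \<open>S\<close> to the closure.\<close>

lemma algebraically_independent_on_closureD:
  assumes "algebraically_independent_on (zariski closure_of S) P d"
  shows "algebraically_independent_on S P d"
  unfolding algebraically_independent_on_def
proof (intro allI impI ballI)
  fix A c a
  assume *: "finite A \<and> (\<forall>a\<in>A. \<forall>i\<ge>d. a i = (0::nat)) \<and>
      (\<forall>x\<in>S. (\<Sum>a\<in>A. c a * (\<Prod>i<d. eval_mpoly (P i) x ^ a i)) = 0)" and "a \<in> A"
  define G where "G = (\<Sum>a\<in>A. Poly_Mapping.single 0 (c a) * (\<Prod>i<d. P i ^ a i))"
  have G: "eval_mpoly G x = (\<Sum>a\<in>A. c a * (\<Prod>i<d. eval_mpoly (P i) x ^ a i))" for x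
    by (simp add: G_def eval_mpoly_sum eval_mpoly_mult eval_mpoly_const eval_mpoly_prod
        eval_mpoly_power)
  show "c a = 0"
  proof (rule algebraically_independent_onD[OF assms, of A c])
    show "(\<Sum>a\<in>A. c a * (\<Prod>i<d. eval_mpoly (P i) x ^ a i)) = 0"
      if "x \<in> zariski closure_of S" for x
      unfolding G[symmetric]
      by (rule eval_mpoly_zero_on_closure[OF _ that]) (use * in \<open>simp add: G\<close>)
  qed (use * \<open>a \<in> A\<close> in simp_all)
qed

text \<open>A chain of length \<open>l\<close> that starts at \<open>Y\<close> and stays in
  \<open>X\<close> yields \<open>d + l\<close> independent functions on \<open>X\<close>, which
  \<open>bound\<close> caps at \<open>d + m\<close>.\<close>

lemma codim_irreducible_le:
  assumes X: "closedin zariski X" and Y: "algebraically_independent_on Y P d"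
    and bound: "\<And>P' d'. algebraically_independent_on X P' d' \<Longrightarrow> d' \<le> d + m"
  shows "codim_irreducible (subtopology zariski X) Y \<le> enat m"
  unfolding codim_irreducible_def
proof (rule Sup_least)
  fix e assume "e \<in> {enat l |l. \<exists>C. irreducible_chain (subtopology zariski X) l C \<and> C 0 = Y}"
  then obtain l C where l: "e = enat l" "irreducible_chain (subtopology zariski X) l C" "C 0 = Y"
    by blast
  then have C: "irreducible_chain zariski l C" "C l \<subseteq> X"
    by (simp_all add: irreducible_chain_subtopology_iff[OF X])
  obtain P' where "algebraically_independent_on (C l) P' (d + l)"
    using algebraically_independent_on_chain[OF C(1)] Y l(3) by blast
  then have "d + l \<le> d + m"
    using bound algebraically_independent_on_mono C(2) by blast
  then show "e \<le> enat m"
    by (simp add: l(1))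
qed

text \<open>Dropping one basis vector at a time gives a flag of irreducible subspaces, and each step
  up adds a function as in a chain.\<close>

lemma algebraically_independent_on_subspace:
  fixes W :: "('k::alg_closed_field ^ 'n::finite) set"
  assumes "vec.subspace W"
  shows "\<exists>P. algebraically_independent_on W P (vec.dim W)"
  using assms
proof (induction "vec.dim W" arbitrary: W)
  case 0
  then show ?case
    using algebraically_independent_on_0[OF vec.subspace_0] by metis
next
  case (Suc d)
  obtain B where B: "B \<subseteq> W" "vec.independent B" "W \<subseteq> vec.span B" "card B = vec.dim W"
    by (rule vec.basis_exists)
  have "B \<noteq> {}"
    using B(4) Suc.hyps(2) by (metis card.empty nat.distinct(1))
  then obtain b where b: "b \<in> B"
    by blast
  let ?W = "vec.span (B - {b})"
  have "vec.independent (B - {b})"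
    using B(2) by (rule vec.independent_mono) blast
  then have "vec.dim ?W = card (B - {b})"
    by (simp add: vec.dim_eq_card_independent)
  then have "d = vec.dim ?W"
    using b B(4) Suc.hyps(2) by simp
  then obtain P where P: "algebraically_independent_on ?W P d"
    using Suc.hyps(1)[of ?W] vec.subspace_span by metis
  have sub: "?W \<subseteq> W"
    using B(1) Suc.prems by (intro vec.span_minimal) auto
  have nb: "b \<notin> ?W"
    using B(2) b by (auto simp: vec.dependent_def)
  obtain q where "\<And>z. z \<in> ?W \<Longrightarrow> eval_mpoly q z = 0" "eval_mpoly q b \<noteq> 0"
    using zariski_separates_point[OF closedin_zariski_subspace[OF vec.subspace_span] nb] by metis
  then have "algebraically_independent_on W (P(d := q)) (Suc d)"
    using algebraically_independent_on_extend[OF P sub irreducible_closedin_subspace[OF Suc.prems]]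
      b B(1) by blast
  then show ?case
    unfolding Suc.hyps(2) by blast
qed

text \<open>These are the binomials of the toric ideal. The relation is split into positive and
  negative parts so that both sides are polynomials and pass from the orbit to its closure.\<close>

lemma orbit_closure_binomial:
  assumes "x \<in> zariski closure_of (torus_orbit w 1)" "(\<Sum>j\<in>UNIV. c j *s w j) = 0"
  shows "(\<Prod>j\<in>UNIV. x $ j ^ nat (c j)) = (\<Prod>j\<in>UNIV. x $ j ^ nat (- c j))"
proof -
  let ?p = "(\<Prod>j\<in>UNIV. mvar j ^ nat (c j)) - (\<Prod>j\<in>UNIV. mvar j ^ nat (- c j))"
  have p: "eval_mpoly ?p y = (\<Prod>j\<in>UNIV. y $ j ^ nat (c j)) - (\<Prod>j\<in>UNIV. y $ j ^ nat (- c j))" for y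
    by (simp add: eval_mpoly_diff eval_mpoly_prod eval_mpoly_power)
  have "(\<Sum>j\<in>UNIV. int (nat (c j)) *s w j) - (\<Sum>j\<in>UNIV. int (nat (- c j)) *s w j) =
      (\<Sum>j\<in>UNIV. c j *s w j)"
    unfolding sum_subtractf[symmetric] vector_sub_rdistrib[symmetric]
    by (intro sum.cong refl arg_cong2[where f = "(*s)"]) simp
  then have eq: "(\<Sum>j\<in>UNIV. int (nat (c j)) *s w j) = (\<Sum>j\<in>UNIV. int (nat (- c j)) *s w j)"
    using assms(2) by simp
  have "eval_mpoly ?p y = 0" if "y \<in> torus_orbit w 1" for y
  proof -
    obtain t where t: "t \<in> torus" "y = torus_action w t 1"
      using \<open>y \<in> torus_orbit w 1\<close> by (auto simp: torus_orbit_def)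
    have "(\<Prod>j\<in>UNIV. torus_char (w j) t ^ nat (c j)) =
        (\<Prod>j\<in>UNIV. torus_char (w j) t ^ nat (- c j))"
      unfolding torus_char_monomial[OF t(1), symmetric] eq ..
    then show ?thesis
      unfolding p by (simp add: t(2) torus_action_def)
  qed
  then have "eval_mpoly ?p x = 0"
    using assms(1) eval_mpoly_zero_on_closure by blast
  then show ?thesis
    unfolding p by simp
qed

lemma orbit_closure_eq_UNIV_iff:
  fixes w :: "'n::finite \<Rightarrow> int ^ 'r::finite"
  shows "zariski closure_of (torus_orbit w (1 :: 'k::alg_closed_field ^ 'n)) = UNIV \<longleftrightarrow>
    independent_weights w"
proof
  assume X: "zariski closure_of (torus_orbit w (1 :: 'k ^ 'n)) = UNIV"
  have nonpos: "c i \<le> 0" if c: "(\<Sum>j\<in>UNIV. c j *s w j) = 0" for c i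
  proof (rule ccontr)
    assume i: "\<not> c i \<le> 0"
    \<comment> \<open>At this point the two sides of the binomial become powers of 0 with exponents
      \<open>nat (c i)\<close> and \<open>nat (- c i)\<close>. The second exponent is 0, so the
      sides are 0 and 1.\<close>
    define x :: "'k ^ 'n" where "x = (\<chi> j. if j = i then 0 else 1)"
    have x: "(\<Prod>j\<in>UNIV. x $ j ^ e j) = 0 ^ e i" for e :: "'n \<Rightarrow> nat"
    proof -
      have "(\<Prod>j\<in>UNIV. x $ j ^ e j) = (\<Prod>j\<in>UNIV. if j = i then 0 ^ e i else 1)"
        by (intro prod.cong) (auto simp: x_def)
      then show ?thesis
        by simp
    qed
    have "(0::'k) ^ nat (c i) = 0 ^ nat (- c i)"
      using orbit_closure_binomial[OF _ c, of x] X by (simp add: x)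
    moreover have "(0::'k) ^ nat (c i) = 0" "nat (- c i) = 0"
      using i by (simp_all add: zero_power)
    ultimately show False
      by simp
  qed
  show "independent_weights w"
    unfolding independent_weights_iff
  proof (intro allI impI)
    fix c j assume c: "(\<Sum>j\<in>UNIV. c j *s w j) = 0"
    have "(\<Sum>j\<in>UNIV. (- c j) *s w j) = - (\<Sum>j\<in>UNIV. c j *s w j)"
      by (simp add: vec_eq_iff sum_negf)
    then have "- c j \<le> 0"
      using nonpos[of "\<lambda>j. - c j" j] c by simp
    then show "c j = 0"
      using nonpos[OF c, of j] by simp
  qed
next
  assume indep: "independent_weights w"
  let ?\<phi> = "\<lambda>m. \<Sum>j\<in>UNIV. int (Poly_Mapping.lookup m j) *s w j"
  have inj: "inj ?\<phi>"
  proof (rule injI)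
    fix m m' assume "?\<phi> m = ?\<phi> m'"
    then have "(\<Sum>j\<in>UNIV. (int (Poly_Mapping.lookup m j) - int (Poly_Mapping.lookup m' j)) *s w j) = 0"
      by (simp add: vector_sub_rdistrib sum_subtractf)
    then have "Poly_Mapping.lookup m j = Poly_Mapping.lookup m' j" for j
      using indep[unfolded independent_weights_iff, THEN spec[of _
            "\<lambda>j. int (Poly_Mapping.lookup m j) - int (Poly_Mapping.lookup m' j)"]] by simp
    then show "m = m'"
      by (rule poly_mapping_eqI)
  qed
  have "x \<in> zariski closure_of (torus_orbit w 1)" for x :: "'k ^ 'n"
    unfolding in_zariski_closure_iff
  proof (intro allI impI)
    fix p :: "('n, 'k) mpoly" assume p: "\<forall>y\<in>torus_orbit w 1. eval_mpoly p y = 0"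
    have "Poly_Mapping.lookup p m = 0" if m: "m \<in> Poly_Mapping.keys p" for m
    proof (rule torus_chars_linear_independent[where \<phi> = ?\<phi> and E = "Poly_Mapping.keys p"])
      show "inj_on ?\<phi> (Poly_Mapping.keys p)"
        using inj by (rule inj_on_subset) simp
      show "(\<Sum>m\<in>Poly_Mapping.keys p. Poly_Mapping.lookup p m * torus_char (?\<phi> m) t) = 0"
        if t: "t \<in> torus" for t :: "'k ^ 'r"
        using p t unfolding eval_mpoly_orbit_1[OF t, symmetric] by (simp add: torus_orbit_def)
    qed (use m in simp_all)
    then show "eval_mpoly p x = 0"
      by (simp add: eval_mpoly_def)
  qed
  then show "zariski closure_of (torus_orbit w (1 :: 'k ^ 'n)) = UNIV"
    by blast
qed

lemma one_in_orbit_closure: "1 \<in> zariski closure_of (torus_orbit w 1)"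
proof -
  have "torus_orbit w 1 \<subseteq> zariski closure_of (torus_orbit w 1)"
    by (rule closure_of_subset) simp
  moreover have "torus_action w 1 1 = 1"
    by (simp add: torus_action_def torus_char_def vec_eq_iff)
  then have "1 \<in> torus_orbit w 1"
    unfolding torus_orbit_def using torus_one by (metis image_eqI)
  ultimately show ?thesis
    by blast
qed

text \<open>At the point \<open>s *s 1\<close> of the cone, the binomial of the relation says that
  \<open>s\<close> to the power of the coefficient sum is 1, for every nonzero
  \<open>s\<close>.\<close>

lemma cone_relation_sum_zero:
  fixes w :: "'n::finite \<Rightarrow> int ^ 'r::finite"
  assumes cone: "closed_affine_cone (zariski closure_of (torus_orbit w (1 :: 'k::alg_closed_field ^ 'n)))"
    and rel: "(\<Sum>j\<in>UNIV. c j *s w j) = 0"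
  shows "(\<Sum>j\<in>UNIV. c j) = 0"
proof (rule power_int_trivial_imp_zero)
  fix s :: 'k assume s: "s \<noteq> 0"
  have "s *s 1 \<in> zariski closure_of (torus_orbit w 1)"
    using cone one_in_orbit_closure unfolding closed_affine_cone_def by blast
  from orbit_closure_binomial[OF this rel]
  have eq: "s ^ (\<Sum>j\<in>UNIV. nat (c j)) = s ^ (\<Sum>j\<in>UNIV. nat (- c j))"
    by (simp add: power_sum)
  have pow: "s powi (int a - int b) = s ^ a / s ^ b" for a b
    using s by (simp add: power_int_diff)
  have "(\<Sum>j\<in>UNIV. c j) = int (\<Sum>j\<in>UNIV. nat (c j)) - int (\<Sum>j\<in>UNIV. nat (- c j))"
    unfolding of_nat_sum sum_subtractf[symmetric] by (intro sum.cong) auto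
  then have "s powi (\<Sum>j\<in>UNIV. c j) = s ^ (\<Sum>j\<in>UNIV. nat (c j)) / s ^ (\<Sum>j\<in>UNIV. nat (- c j))"
    by (simp only: pow)
  then show "s powi (\<Sum>j\<in>UNIV. c j) = 1"
    using s eq by simp
qed

section \<open>Regularity of the orbit map and irreducibility of orbit closures\<close>

lemma regular_on_torus_const: "regular_on_torus (\<lambda>_. c)"
  unfolding regular_on_torus_def
  by (rule exI[of _ "Poly_Mapping.single 0 c"], rule exI[of _ 0]) (simp add: eval_mpoly_const)

lemma regular_on_torus_add:
  assumes "regular_on_torus f" "regular_on_torus g"
  shows "regular_on_torus (\<lambda>t. f t + g t)"
proof -
  obtain p N where p: "\<And>t. t \<in> torus \<Longrightarrow> f t = eval_mpoly p t / (\<Prod>i\<in>UNIV. t $ i) ^ N"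
    using assms(1) unfolding regular_on_torus_def by blast
  obtain q M where q: "\<And>t. t \<in> torus \<Longrightarrow> g t = eval_mpoly q t / (\<Prod>i\<in>UNIV. t $ i) ^ M"
    using assms(2) unfolding regular_on_torus_def by blast
  let ?D = "\<Prod>i\<in>UNIV. mvar i"
  have "f t + g t = eval_mpoly (p * ?D ^ M + q * ?D ^ N) t / (\<Prod>i\<in>UNIV. t $ i) ^ (N + M)"
    if "t \<in> torus" for t
    using that by (simp add: p q eval_mpoly_add eval_mpoly_mult eval_mpoly_power eval_mpoly_prod
        power_add torus_def field_simps)
  then show ?thesis
    unfolding regular_on_torus_def by blast
qed

lemma regular_on_torus_mult:
  assumes "regular_on_torus f" "regular_on_torus g"
  shows "regular_on_torus (\<lambda>t. f t * g t)"
proof -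
  obtain p N where p: "\<And>t. t \<in> torus \<Longrightarrow> f t = eval_mpoly p t / (\<Prod>i\<in>UNIV. t $ i) ^ N"
    using assms(1) unfolding regular_on_torus_def by blast
  obtain q M where q: "\<And>t. t \<in> torus \<Longrightarrow> g t = eval_mpoly q t / (\<Prod>i\<in>UNIV. t $ i) ^ M"
    using assms(2) unfolding regular_on_torus_def by blast
  have "f t * g t = eval_mpoly (p * q) t / (\<Prod>i\<in>UNIV. t $ i) ^ (N + M)" if "t \<in> torus" for t
    using that by (simp add: p q eval_mpoly_mult power_add)
  then show ?thesis
    unfolding regular_on_torus_def by blast
qed

lemma regular_on_torus_power: "regular_on_torus f \<Longrightarrow> regular_on_torus (\<lambda>t. f t ^ m)"
  by (induction m) (simp_all add: regular_on_torus_const regular_on_torus_mult)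

lemma regular_on_torus_prod:
  "(\<And>a. a \<in> A \<Longrightarrow> regular_on_torus (f a)) \<Longrightarrow> regular_on_torus (\<lambda>t. \<Prod>a\<in>A. f a t)"
  by (induction A rule: infinite_finite_induct)
    (simp_all add: regular_on_torus_const regular_on_torus_mult)

lemma regular_on_torus_sum:
  "(\<And>a. a \<in> A \<Longrightarrow> regular_on_torus (f a)) \<Longrightarrow> regular_on_torus (\<lambda>t. \<Sum>a\<in>A. f a t)"
  by (induction A rule: infinite_finite_induct)
    (simp_all add: regular_on_torus_const regular_on_torus_add)

lemma regular_on_torus_orbit_map:
  "regular_on_torus (\<lambda>t :: 'k::field ^ 'r::finite. eval_mpoly p (torus_action w t x))"
proof -
  have "regular_on_torus (\<lambda>t. \<Sum>m\<in>Poly_Mapping.keys p. Poly_Mapping.lookup p m *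
      (\<Prod>j\<in>UNIV. (torus_char (w j) t * x $ j) ^ Poly_Mapping.lookup m j))"
    by (intro regular_on_torus_sum regular_on_torus_mult regular_on_torus_const
        regular_on_torus_prod regular_on_torus_power regular_torus_char)
  then show ?thesis
    by (simp add: eval_mpoly_def torus_action_def)
qed

text \<open>Pulled back along the orbit map, polynomials become Laurent polynomials, so
  irreducibility is inherited from the affine space containing the torus.\<close>

lemma irreducible_closedin_orbit_closure:
  fixes x :: "'k::alg_closed_field ^ 'n::finite" and w :: "'n \<Rightarrow> int ^ 'r::finite"
  shows "irreducible_closedin zariski (zariski closure_of (torus_orbit w x))"
proof (rule irreducible_closedin_zariskiI)
  let ?O = "torus_orbit w x"
  have sub: "?O \<subseteq> zariski closure_of ?O"
    by (rule closure_of_subset) simp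
  show "zariski closure_of ?O \<noteq> {}"
    using sub torus_one by (auto simp: torus_orbit_def)
  fix p q y z
  assume y: "y \<in> zariski closure_of ?O" "eval_mpoly p y \<noteq> 0"
    and z: "z \<in> zariski closure_of ?O" "eval_mpoly q z \<noteq> 0"
  obtain s where s: "s \<in> torus" "eval_mpoly p (torus_action w s x) \<noteq> 0"
    using y unfolding in_zariski_closure_iff torus_orbit_def by blast
  obtain t where t: "t \<in> torus" "eval_mpoly q (torus_action w t x) \<noteq> 0"
    using z unfolding in_zariski_closure_iff torus_orbit_def by blast
  obtain p' N where p': "\<And>t :: 'k ^ 'r. t \<in> torus \<Longrightarrow>
      eval_mpoly p (torus_action w t x) = eval_mpoly p' t / (\<Prod>i\<in>UNIV. t $ i) ^ N"
    using regular_on_torus_orbit_map[of p w x] unfolding regular_on_torus_def by blast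
  obtain q' M where q': "\<And>t :: 'k ^ 'r. t \<in> torus \<Longrightarrow>
      eval_mpoly q (torus_action w t x) = eval_mpoly q' t / (\<Prod>i\<in>UNIV. t $ i) ^ M"
    using regular_on_torus_orbit_map[of q w x] unfolding regular_on_torus_def by blast
  let ?D = "\<Prod>i\<in>UNIV. mvar i"
  have D: "eval_mpoly ?D t \<noteq> 0 \<longleftrightarrow> t \<in> torus" for t :: "'k ^ 'r"
    by (auto simp: eval_mpoly_prod torus_def)
  \<comment> \<open>The factor \<open>?D\<close>, the product of the variables, forces the common
    nonzero point \<open>r\<close> into the torus.\<close>
  have "eval_mpoly (p' * ?D) s \<noteq> 0" "eval_mpoly q' t \<noteq> 0"
    using s t p'[of s] q'[of t] D[of s] by (auto simp: eval_mpoly_mult)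
  then obtain r where r: "eval_mpoly (p' * ?D) r \<noteq> 0" "eval_mpoly q' r \<noteq> 0"
    using subspace_common_nonzero[OF vec.subspace_UNIV] by blast
  then have rt: "r \<in> torus"
    using D[of r] by (auto simp: eval_mpoly_mult)
  then have "(\<Prod>i\<in>UNIV. r $ i) \<noteq> 0"
    by (simp add: torus_def)
  then have "eval_mpoly p (torus_action w r x) \<noteq> 0" "eval_mpoly q (torus_action w r x) \<noteq> 0"
    using r by (simp_all add: p'[OF rt] q'[OF rt] eval_mpoly_mult)
  then show "\<exists>z\<in>zariski closure_of ?O. eval_mpoly p z \<noteq> 0 \<and> eval_mpoly q z \<noteq> 0"
    using rt sub by (auto simp: torus_orbit_def)
qed simp

lemma power_int_sum:
  fixes s :: "'k::field"
  assumes "s \<noteq> 0"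
  shows "s powi (\<Sum>i\<in>A. f i) = (\<Prod>i\<in>A. s powi f i)"
  using assms by (induction A rule: infinite_finite_induct) (simp_all add: power_int_add)

text \<open>The functional \<open>u\<close> is a one-parameter subgroup of the torus. Letting its parameter tend to
  \<open>0\<close> kills the coordinates on which \<open>u\<close> is positive and fixes the others.\<close>

lemma face_orbit_subset_closure:
  fixes w :: "'n::finite \<Rightarrow> int ^ 'r::finite"
  assumes u: "\<And>j. scalar_product u (w j) \<ge> 0"
  defines "x \<equiv> (\<chi> j. if scalar_product u (w j) = 0 then 1 else 0) :: 'k::alg_closed_field ^ 'n"
  shows "torus_orbit w x \<subseteq> zariski closure_of (torus_orbit w 1)"
proof
  fix y assume "y \<in> torus_orbit w x"
  then obtain t where t: "t \<in> torus" "y = torus_action w t x"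
    by (auto simp: torus_orbit_def)
  define e where "e j = nat (scalar_product u (w j))" for j
  \<comment> \<open>Coordinates of the curve traced by the one-parameter subgroup through the orbit
    point of \<open>t\<close>. Nonnegativity of \<open>u\<close> on the weights makes them
    polynomials, so the curve extends to parameter 0, where it meets \<open>y\<close>.\<close>
  let ?q = "\<lambda>j. monom (torus_char (w j) t) (e j)"
  show "y \<in> zariski closure_of (torus_orbit w 1)"
    unfolding in_zariski_closure_iff
  proof (intro allI impI)
    fix p :: "('n, 'k) mpoly" assume p: "\<forall>y\<in>torus_orbit w 1. eval_mpoly p y = 0"
    obtain Q where Q: "\<And>s. eval_mpoly p (\<chi> j. poly (?q j) s) = poly Q s"
      using eval_mpoly_poly_curve[of p ?q] by blast
    have "Q = 0"
    proof (rule poly_eq_zero_if_zero_on_units)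
      fix s :: 'k assume s: "s \<noteq> 0"
      define r :: "'k ^ 'r" where "r = (\<chi> i. s powi (u $ i))"
      have r: "r * t \<in> torus"
        using s t(1) by (intro torus_mult) (simp_all add: r_def torus_def)
      have "torus_char (w j) r = s ^ e j" for j
      proof -
        have "torus_char (w j) r = s powi (scalar_product u (w j))"
          by (simp add: torus_char_def r_def scalar_product_def power_int_sum[OF s] power_int_mult)
        also have "\<dots> = s ^ e j"
          using u[of j] by (simp add: e_def power_int_def)
        finally show ?thesis .
      qed
      then have "(\<chi> j. poly (?q j) s) = torus_action w (r * t) 1"
        by (simp add: torus_action_def torus_char_mult poly_monom vec_eq_iff)
      then have "(\<chi> j. poly (?q j) s) \<in> torus_orbit w 1"
        using r by (simp add: torus_orbit_def)
      then show "poly Q s = 0"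
        using p Q by metis
    qed
    moreover have "(\<chi> j. poly (?q j) 0) = y"
      using u by (auto simp: t(2) torus_action_def vec_eq_iff x_def e_def poly_monom
          order_le_less zero_power)
    ultimately show "eval_mpoly p y = 0"
      using Q[of 0] by simp
  qed
qed

text \<open>The lower bound comes from explicit chains through a hyperplane, the upper bound from
  \<open>vec.dim W\<close> independent functions on \<open>W\<close>. Viewing the whole space as an
  orbit closure lets the counting argument bound the independent functions on it by
  \<open>CARD('n)\<close>.\<close>

lemma strong_separation_property_UNIV:
  fixes w :: "'n::finite \<Rightarrow> int ^ 'r::finite"
  assumes X: "zariski closure_of (torus_orbit w (1 :: 'k::alg_closed_field ^ 'n)) = UNIV"
    and dim: "krull_dim (zariski :: ('k ^ 'n) topology) \<ge> 2"
  shows "strong_separation_property (UNIV :: ('k ^ 'n) set)"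
  unfolding strong_separation_property_def
proof (intro conjI allI impI)
  show "closed_affine_cone (UNIV :: ('k ^ 'n) set)"
    using closedin_topspace[of zariski] by (simp add: closed_affine_cone_def)
  show "krull_dim (subtopology zariski (UNIV :: ('k ^ 'n) set)) \<ge> 2"
    using dim by simp
  fix W :: "('k ^ 'n) set"
  assume W: "vec.subspace W \<and> vec.dim W + 2 = CARD('n)"
  have UNIV: "vec.dim (UNIV :: ('k ^ 'n) set) = CARD('n)"
    by (rule vec_dim_card)
  then have "W \<noteq> UNIV"
    using W by auto
  then obtain v where v: "v \<notin> W"
    by blast
  define H where "H = vec.span (insert v W)"
  have H: "irreducible_closedin zariski H"
    unfolding H_def by (intro irreducible_closedin_subspace vec.subspace_span)
  have spanW: "vec.span W = W"
    using W by simp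
  have WH: "W \<subset> H"
    using v vec.span_superset[of "insert v W"] unfolding H_def by blast
  have "vec.dim H = vec.dim W + 1"
    using v by (simp add: H_def vec.dim_insert spanW)
  then have HU: "H \<subset> UNIV"
    using UNIV W by auto
  have "codim_in zariski W \<ge> 2"
    unfolding codim_in_def
  proof (rule Inf_greatest)
    fix e assume "e \<in> {codim_irreducible zariski Y |Y. irreducible_closedin zariski Y \<and> Y \<subseteq> W}"
    then obtain Y where Y: "e = codim_irreducible zariski Y" "irreducible_closedin zariski Y" "Y \<subseteq> W"
      by blast
    \<comment> \<open>Since \<open>H\<close> strictly contains \<open>W\<close>, the first inclusion
      is strict for every \<open>Y\<close> inside \<open>W\<close>, including \<open>W\<close>
      itself.\<close>
    define C where "C i = (if i = 0 then Y else if i = 1 then H else UNIV)" for i :: nat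
    have "irreducible_closedin zariski (C i)" for i
      using Y(2) H irreducible_closedin_subspace[of "UNIV :: ('k ^ 'n) set"]
      by (simp add: C_def vec.subspace_UNIV)
    moreover have "C i \<subset> C (Suc i)" if "i < 2" for i
      using that Y(3) WH HU by (auto simp: C_def less_2_cases_iff)
    ultimately have "irreducible_chain zariski 2 C \<and> C 0 = Y"
      by (simp add: irreducible_chain_def C_def)
    then have "enat 2 \<le> e"
      unfolding Y(1) codim_irreducible_def by (intro Sup_upper) blast
    then show "2 \<le> e"
      by (simp add: numeral_eq_enat)
  qed
  moreover have "codim_in zariski W \<le> 2"
  proof -
    obtain P where "algebraically_independent_on W P (vec.dim W)"
      using algebraically_independent_on_subspace W by blast
    then have "codim_irreducible (subtopology zariski UNIV) W \<le> enat 2"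
    proof (rule codim_irreducible_le[rotated])
      show "closedin zariski (UNIV :: ('k ^ 'n) set)"
        using closedin_topspace[of zariski] by simp
      fix P' :: "nat \<Rightarrow> ('n, 'k) mpoly" and d'
      assume "algebraically_independent_on UNIV P' d'"
      then have "algebraically_independent_on (torus_orbit w 1) P' d'"
        using algebraically_independent_on_closureD[of "torus_orbit w 1" P' d'] X by simp
      then have "d' \<le> card (UNIV :: 'n set)"
      proof (rule algebraically_independent_on_orbit_le)
        show "1 *s w j = (\<Sum>b\<in>UNIV. (if b = j then 1 else 0) *s w b)" for j
        proof -
          have "(\<Sum>b\<in>UNIV. (if b = j then 1 else 0) *s w b) = (\<Sum>b\<in>UNIV. if b = j then w j else 0)"
            by (intro sum.cong) auto
          then show ?thesis
            by simp
        qed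
      qed simp
      then show "d' \<le> vec.dim W + 2"
        using W by simp
    qed
    moreover have "codim_in zariski W \<le> codim_irreducible zariski W"
      unfolding codim_in_def using W irreducible_closedin_subspace by (intro Inf_lower) blast
    ultimately show ?thesis
      by (simp add: numeral_eq_enat)
  qed
  ultimately show "codim_in (subtopology zariski UNIV) (W \<inter> UNIV) = 2"
    by simp
qed

lemma not_strong_separation_property_if_dependent:
  fixes w :: "'n::finite \<Rightarrow> int ^ 'r::finite"
  defines "X \<equiv> zariski closure_of (torus_orbit w (1 :: 'k::alg_closed_field ^ 'n))"
  assumes cone: "closed_affine_cone X" and dep: "\<not> independent_weights w"
  shows "\<not> strong_separation_property X"
proof
  assume ssp: "strong_separation_property X"
  obtain c p where c: "(\<Sum>j\<in>UNIV. c j *s w j) = 0" "c p \<noteq> 0"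
    using dep unfolding independent_weights_iff by blast
  define v where "v j = rat_weight (w j)" for j
  \<comment> \<open>Homogeneity is known for integral relations; clearing denominators gives the
    rational form required for the functional \<open>h\<close>.\<close>
  have "(\<Sum>j\<in>UNIV. a j) = 0" if a: "(\<Sum>j\<in>UNIV. a j *s v j) = 0" for a
  proof -
    obtain M k where k: "M > 0" "\<And>j. of_int M * a j = of_int (k j)"
      using common_denominator[of UNIV a] by auto
    have "rat_weight (\<Sum>j\<in>UNIV. k j *s w j) = (\<Sum>j\<in>UNIV. (of_int M * a j) *s v j)"
      by (simp add: k(2) rat_weight_sum rat_weight_scale v_def)
    also have "\<dots> = of_int M *s (\<Sum>j\<in>UNIV. a j *s v j)"
      by (simp add: vec.scale_sum_right)
    finally have "(\<Sum>j\<in>UNIV. k j *s w j) = 0"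
      by (simp add: a rat_weight_eq_0_iff)
    then have "(\<Sum>j\<in>UNIV. k j) = 0"
      by (rule cone_relation_sum_zero[OF cone[unfolded X_def]])
    then have "of_int M * (\<Sum>j\<in>UNIV. a j) = 0"
      unfolding sum_distrib_left k(2) by (simp flip: of_int_sum)
    then show ?thesis
      using k(1) by simp
  qed
  then obtain h where h: "\<And>j. scalar_product h (v j) = 1"
    using affine_functional_exists[of v] by metis
  have "scalar_product h (v j) > 0" for j
    by (simp add: h)
  then obtain u' where u': "\<forall>j. scalar_product u' (v j) \<ge> 0" "scalar_product u' (v p) > 0"
    "\<forall>j. v j \<in> vec.span (v ` insert p {j. scalar_product u' (v j) = 0})"
    using facet_not_containing[of h v p] by blast
  obtain M u where M: "M > 0"
    and u: "\<And>a. rat_of_int (scalar_product u a) = of_int M * scalar_product u' (rat_weight a)"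
    using integral_functional[of u'] by metis
  have nonneg: "scalar_product u (w j) \<ge> 0" for j
  proof -
    have "rat_of_int (scalar_product u (w j)) \<ge> 0"
      unfolding u using M u'(1) by (simp add: v_def)
    then show ?thesis
      by simp
  qed
  have zero_iff: "scalar_product u (w j) = 0 \<longleftrightarrow> scalar_product u' (v j) = 0" for j
  proof -
    have "rat_of_int (scalar_product u (w j)) = 0 \<longleftrightarrow> scalar_product u' (v j) = 0"
      unfolding u using M by (simp add: v_def)
    then show ?thesis
      by simp
  qed
  define Z where "Z = {j. scalar_product u (w j) = 0}"
  have Z: "v j \<in> vec.span (v ` insert p Z)" for j
    using u'(3) by (simp add: Z_def zero_iff)
  have p: "p \<notin> Z"
    using u'(2) by (simp add: Z_def zero_iff)
  have "\<exists>q. q \<noteq> p \<and> q \<notin> Z"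
  proof (rule ccontr)
    assume "\<not> ?thesis"
    then have q: "scalar_product u (w j) = 0" if "j \<noteq> p" for j
      using that by (auto simp: Z_def)
    have "(\<Sum>j\<in>UNIV. c j * scalar_product u (w j)) = scalar_product u (\<Sum>j\<in>UNIV. c j *s w j)"
      unfolding scalar_product_def sum_component vector_smult_component sum_distrib_left
      by (subst sum.swap) (simp add: mult_ac)
    also have "\<dots> = 0"
      by (simp add: c(1) scalar_product_def)
    also have "(\<Sum>j\<in>UNIV. c j * scalar_product u (w j)) =
        (\<Sum>j\<in>UNIV. if j = p then c p * scalar_product u (w p) else 0)"
      by (intro sum.cong) (auto simp: q)
    finally show False
      using c(2) p by (simp add: Z_def)
  qed
  then obtain q where q: "q \<noteq> p" "q \<notin> Z"
    by blast
  \<comment> \<open>The distinguished point of the facet: the limit of the point 1 along the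
    one-parameter subgroup \<open>u\<close>.\<close>
  define x :: "'k ^ 'n" where "x = (\<chi> j. if scalar_product u (w j) = 0 then 1 else 0)"
  define Y where "Y = zariski closure_of (torus_orbit w x)"
  have Y: "irreducible_closedin zariski Y"
    unfolding Y_def by (rule irreducible_closedin_orbit_closure)
  have X: "closedin zariski X"
    by (simp add: X_def)
  have YX: "Y \<subseteq> X"
    unfolding Y_def x_def
    by (rule closure_of_minimal[OF _ X]) (use face_orbit_subset_closure[OF nonneg] in \<open>simp add: X_def\<close>)
  define W where "W = {x :: 'k ^ 'n. \<forall>i. i \<notin> - {p, q} \<longrightarrow> x $ i = 0}"
  have W: "vec.subspace W"
    by (auto simp: W_def intro!: vec.subspaceI)
  have "card {p, q} \<le> CARD('n)"
    by (intro card_mono) simp_all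
  then have dimW: "vec.dim W + 2 = CARD('n)"
    unfolding W_def dim_substandard_cart using q(1) by (simp add: Compl_eq_Diff_UNIV card_Diff_subset)
  have YW: "Y \<subseteq> W"
    unfolding Y_def
  proof (rule closure_of_minimal[OF _ closedin_zariski_subspace[OF W]])
    show "torus_orbit w x \<subseteq> W"
      using p q by (auto simp: torus_orbit_def torus_action_def W_def x_def Z_def)
  qed
  \<comment> \<open>\<open>B\<close> picks one index for each vector of a basis of the span of the
    facet weights. Its coordinates are independent functions on \<open>Y\<close>, while
    \<open>B\<close> and \<open>p\<close> together span all weights, so \<open>X\<close> has at most
    one more.\<close>
  obtain Bv where Bv: "Bv \<subseteq> v ` Z" "vec.independent Bv" "v ` Z \<subseteq> vec.span Bv"
    by (rule vec.basis_exists)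
  then obtain B where B: "B \<subseteq> Z" "inj_on v B" "Bv = v ` B"
    unfolding subset_image_inj by blast
  obtain \<beta> where \<beta>: "bij_betw \<beta> {..<card B} B"
    using ex_bij_betw_nat_finite[of B] by (auto simp: lessThan_atLeast0)
  have B_rel: "\<forall>c. (\<Sum>j\<in>B. c j *s w j) = 0 \<longrightarrow> (\<forall>j\<in>B. c j = 0)"
    using independent_family_iff[of B v] B(2) Bv(2) rational_relations_trivial_iff[of B w]
    unfolding B(3) v_def by simp
  have "algebraically_independent_on (torus_orbit w x) (\<lambda>i. mvar (\<beta> i)) (card B)"
  proof (rule algebraically_independent_on_orbit)
    show "x $ \<beta> i = 1" if "i < card B" for i
      using bij_betwE[OF \<beta>] that B(1) by (auto simp: x_def Z_def)
    fix a :: "nat \<Rightarrow> int" assume a: "(\<Sum>i<card B. a i *s w (\<beta> i)) = 0"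
    let ?a = "\<lambda>j. a (inv_into {..<card B} \<beta> j)"
    have inv: "?a (\<beta> i) = a i" if "i < card B" for i
      using \<beta> that by (simp add: bij_betw_def inv_into_f_f)
    have "(\<Sum>j\<in>B. ?a j *s w j) = (\<Sum>i<card B. ?a (\<beta> i) *s w (\<beta> i))"
      by (rule sum.reindex_bij_betw[OF \<beta>, symmetric])
    also have "\<dots> = 0"
      using a by (simp add: inv)
    finally have "\<forall>j\<in>B. ?a j = 0"
      using B_rel[THEN spec[of _ ?a]] by blast
    then show "\<forall>i<card B. a i = 0"
      using inv bij_betwE[OF \<beta>] by (metis lessThan_iff)
  qed
  then have Y_indep: "algebraically_independent_on Y (\<lambda>i. mvar (\<beta> i)) (card B)"
    unfolding Y_def by (rule algebraically_independent_on_mono) (simp add: closure_of_subset)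
  have "v j \<in> vec.span (v ` insert p B)" for j
  proof -
    have "v ` Z \<subseteq> vec.span (v ` insert p B)"
      using Bv(3) vec.span_mono[of "v ` B" "v ` insert p B"] unfolding B(3) by blast
    moreover have "v p \<in> vec.span (v ` insert p B)"
      by (rule vec.span_base) simp
    ultimately have "vec.span (v ` insert p Z) \<subseteq> vec.span (v ` insert p B)"
      by (intro vec.span_minimal vec.subspace_span) simp
    then show ?thesis
      using Z by blast
  qed
  then obtain M C where MC: "M \<noteq> 0" "\<And>j. M *s w j = (\<Sum>b\<in>insert p B. C j b *s w b)"
    using integer_span_coefficients[of w "insert p B"] unfolding v_def by blast
  have "codim_irreducible (subtopology zariski X) Y \<le> enat 1"
  proof (rule codim_irreducible_le[OF X Y_indep])
    fix P' :: "nat \<Rightarrow> ('n, 'k) mpoly" and d'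
    assume "algebraically_independent_on X P' d'"
    then have "d' \<le> card (insert p B)"
      unfolding X_def
      using algebraically_independent_on_orbit_le[OF algebraically_independent_on_closureD MC] by blast
    also have "\<dots> \<le> card B + 1"
      using B(1) p by (simp add: card_insert_if)
    finally show "d' \<le> card B + 1" .
  qed
  moreover have "codim_in (subtopology zariski X) (W \<inter> X) \<le> codim_irreducible (subtopology zariski X) Y"
    unfolding codim_in_def using Y YX YW irreducible_closedin_subtopology_iff[OF X]
    by (intro Inf_lower) blast
  ultimately have "codim_in (subtopology zariski X) (W \<inter> X) \<le> enat 1"
    by (rule order_trans[rotated])
  moreover have "codim_in (subtopology zariski X) (W \<inter> X) = 2"
    using ssp W dimW unfolding strong_separation_property_def by blast
  ultimately show False
    by (simp add: numeral_eq_enat)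
qed

theorem theorem5:
  fixes w :: "'n::finite \<Rightarrow> int ^ 'r::finite"
    and X :: "('k::alg_closed_field ^ 'n) set"
  assumes X: "X = zariski closure_of (torus_orbit w 1)"
    and cone: "closed_affine_cone X"
    and dim: "krull_dim (subtopology zariski X) \<ge> 2"
  shows "(strong_separation_property X \<longleftrightarrow> X = UNIV) \<and> (X = UNIV \<longleftrightarrow> independent_weights w)"
proof
  show indep: "X = UNIV \<longleftrightarrow> independent_weights w"
    unfolding X by (rule orbit_closure_eq_UNIV_iff)
  show "strong_separation_property X \<longleftrightarrow> X = UNIV"
  proof
    assume "strong_separation_property X"
    then show "X = UNIV"
      using not_strong_separation_property_if_dependent[of w, where 'k = 'k] cone indep X by blast
  next
    assume "X = UNIV"
    then show "strong_separation_property X"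
      using strong_separation_property_UNIV[of w, where 'k = 'k] X dim by simp
  qed
qed

end
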